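(* Let $X$ be a quandle and $G$ an abelian group. There is a long exact sequence $$\cdots\stackrel{\partial_*}{\to}H_n^{\rm D}(X;G)\stackrel{i_*}{\to}H_n^{\rm R}(X;G)\stackrel{j_*}{\to}H_n^{\rm Q}(X;G)\stackrel{\partial_*}{\to}H_{n-1}^{\rm D}(X;G)\to\cdots$$ which is natural with respect to homomorphisms induced from quandle homomorphisms. Here $i_*$ and $j_*$ are induced by the inclusion $i:C_*^{\rm D}(X)\to C_*^{\rm R}(X)$ and the quotient map $j:C_*^{\rm R}(X)\to C_*^{\rm Q}(X)$.
   Context: A quandle is a set $X$ with a binary operation $*$ such that $a*a=a$; for all $a,b$ there is a unique $c$ with $a=c*b$; and $(a*b)*c=(a*c)*(b*c)$. Homomorphisms are maps preserving $*$. For $n\ge1$, $C_n^{\rm R}(X)$ is the free abelian group on $n$-tuples $(x_1,\dots,x_n)\in X^n$, $C_n^{\rm R}(X)=0$ for $n\le0$; for $n\ge2$ $$\partial_n(x_1,\dots,x_n)=\sum_{i=2}^n(-1)^i\big[(x_1,\dots,x_{i-1},x_{i+1},\dots,x_n)-(x_1*x_i,\dots,x_{i-1}*x_i,x_{i+1},\dots,x_n)\big],$$ and $\partial_n=0$ for $n\le1$. $C_n^{\rm D}(X)\subset C_n^{\rm R}(X)$ is the subgroup generated by tuples with $x_i=x_{i+1}$ for some $i\in\{1,\dots,n-1\}$ if $n\ge2$, and $0$ if $n\le1$; it is a subcomplex. $C_n^{\rm Q}(X)=C_n^{\rm R}(X)/C_n^{\rm D}(X)$ with induced boundary. For ${\rm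 W}\in\{{\rm D},{\rm R},{\rm Q}\}$, $H_n^{\rm W}(X;G)=H_n(C_*^{\rm W}(X)\otimes G)$. A quandle homomorphism $f:X\to Y$ induces chain maps $(x_1,\dots,x_n)\mapsto(f(x_1),\dots,f(x_n))$ and hence homomorphisms $f_*:H_n^{\rm W}(X;G)\to H_n^{\rm W}(Y;G)$. *)

theory Defs
  imports "HOL-Algebra.Free_Abelian_Groups"
begin

section \<open>Quandles\<close>

locale quandle =
  fixes X :: "'a set" and star :: "'a \<Rightarrow> 'a \<Rightarrow> 'a" (infixl \<open>\<star>\<close> 70)
  assumes closed: "\<lbrakk>a \<in> X; b \<in> X\<rbrakk> \<Longrightarrow> a \<star> b \<in> X"
    and idem: "a \<in> X \<Longrightarrow> a \<star> a = a"
    and right_div: "\<lbrakk>a \<in> X; b \<in> X\<rbrakk> \<Longrightarrow> \<exists>!c. c \<in> X \<and> a = c \<star> b"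
    and self_distrib: "\<lbrakk>a \<in> X; b \<in> X; c \<in> X\<rbrakk> \<Longrightarrow> (a \<star> b) \<star> c = (a \<star> c) \<star> (b \<star> c)"

definition quandle_hom ::
  "'a set \<Rightarrow> ('a \<Rightarrow> 'a \<Rightarrow> 'a) \<Rightarrow> 'b set \<Rightarrow> ('b \<Rightarrow> 'b \<Rightarrow> 'b) \<Rightarrow> ('a \<Rightarrow> 'b) set"
  where "quandle_hom X s Y t =
    {f. f \<in> X \<rightarrow> Y \<and> (\<forall>a\<in>X. \<forall>b\<in>X. f (s a b) = t (f a) (f b))}"


section \<open>Quotients, tensor products and complexes of abelian groups\<close>

text \<open>
  The map between quotient groups induced by \<open>f\<close>: if \<open>f\<close> maps \<open>A\<close> to \<open>B\<close> and a subgroup \<open>H\<close>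
  of \<open>A\<close> into the subgroup \<open>K\<close> of \<open>B\<close>, then the coset of \<open>x\<close> modulo \<open>H\<close> is mapped to the
  coset of \<open>f x\<close> modulo \<open>K\<close>; all members of the union below are then the same coset.
\<close>

definition quot_map :: "('b, 'm) monoid_scheme \<Rightarrow> 'b set \<Rightarrow> ('a \<Rightarrow> 'b) \<Rightarrow> 'a set \<Rightarrow> 'b set"
  where "quot_map B K f S = (\<Union>x\<in>S. K #>\<^bsub>B\<^esub> f x)"

text \<open>
  The tensor product (over the integers) of two abelian groups, both written multiplicatively:
  the free abelian group on pairs modulo the bilinearity relations.
\<close>

definition tensor_rel ::
  "('a, 'm) monoid_scheme \<Rightarrow> ('g, 'k) monoid_scheme \<Rightarrow> ('a \<times> 'g \<Rightarrow>\<^sub>0 int) set"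
  where "tensor_rel A G = generate (free_Abelian_group (carrier A \<times> carrier G))
    ({frag_of (a \<otimes>\<^bsub>A\<^esub> a', g) - frag_of (a, g) - frag_of (a', g) |a a' g.
        a \<in> carrier A \<and> a' \<in> carrier A \<and> g \<in> carrier G} \<union>
     {frag_of (a, g \<otimes>\<^bsub>G\<^esub> g') - frag_of (a, g) - frag_of (a, g') |a g g'.
        a \<in> carrier A \<and> g \<in> carrier G \<and> g' \<in> carrier G})"

definition tensor ::
  "('a, 'm) monoid_scheme \<Rightarrow> ('g, 'k) monoid_scheme \<Rightarrow> ('a \<times> 'g \<Rightarrow>\<^sub>0 int) set monoid"
  where "tensor A G = free_Abelian_group (carrier A \<times> carrier G) Mod tensor_rel A G"

text \<open>The homomorphism \<open>f \<otimes> id\<close> into the tensor product of \<open>B\<close> and \<open>G\<close>.\<close>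

definition tensor_map ::
  "('b, 'm) monoid_scheme \<Rightarrow> ('g, 'k) monoid_scheme \<Rightarrow> ('a \<Rightarrow> 'b)
    \<Rightarrow> ('a \<times> 'g \<Rightarrow>\<^sub>0 int) set \<Rightarrow> ('b \<times> 'g \<Rightarrow>\<^sub>0 int) set"
  where "tensor_map B G f =
    quot_map (free_Abelian_group (carrier B \<times> carrier G)) (tensor_rel B G)
      (frag_extend (\<lambda>(a, g). frag_of (f a, g)))"

text \<open>\<open>bdry C n\<close> is the boundary from degree \<open>n\<close> to degree \<open>n - 1\<close>.\<close>

record 'c chain_complex =
  chains :: "int \<Rightarrow> 'c monoid"
  bdry :: "int \<Rightarrow> 'c \<Rightarrow> 'c"

definition tensor_complex ::
  "'c chain_complex \<Rightarrow> ('g, 'k) monoid_scheme \<Rightarrow> ('c \<times> 'g \<Rightarrow>\<^sub>0 int) set chain_complex"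
  where "tensor_complex C G =
    \<lparr>chains = (\<lambda>n. tensor (chains C n) G),
     bdry = (\<lambda>n. tensor_map (chains C (n - 1)) G (bdry C n))\<rparr>"

definition tensor_chain_map ::
  "'d chain_complex \<Rightarrow> ('g, 'k) monoid_scheme \<Rightarrow> (int \<Rightarrow> 'c \<Rightarrow> 'd)
    \<Rightarrow> int \<Rightarrow> ('c \<times> 'g \<Rightarrow>\<^sub>0 int) set \<Rightarrow> ('d \<times> 'g \<Rightarrow>\<^sub>0 int) set"
  where "tensor_chain_map D G \<phi> n = tensor_map (chains D n) G (\<phi> n)"

definition cycle_group :: "'c chain_complex \<Rightarrow> int \<Rightarrow> 'c monoid"
  where "cycle_group C n =
    subgroup_generated (chains C n) (kernel (chains C n) (chains C (n - 1)) (bdry C n))"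

definition boundaries :: "'c chain_complex \<Rightarrow> int \<Rightarrow> 'c set"
  where "boundaries C n = bdry C (n + 1) ` carrier (chains C (n + 1))"

definition homology :: "'c chain_complex \<Rightarrow> int \<Rightarrow> 'c set monoid"
  where "homology C n = cycle_group C n Mod boundaries C n"

definition homology_map :: "'d chain_complex \<Rightarrow> (int \<Rightarrow> 'c \<Rightarrow> 'd) \<Rightarrow> int \<Rightarrow> 'c set \<Rightarrow> 'd set"
  where "homology_map D \<phi> n = quot_map (cycle_group D n) (boundaries D n) (\<phi> n)"

text \<open>
  The connecting homomorphism from the \<open>n\<close>-th homology of \<open>C\<close> to the \<open>(n - 1)\<close>-st homology of
  \<open>A\<close> for a short exact sequence of complexes \<open>i : A \<rightarrow> B\<close>, \<open>j : B \<rightarrow> C\<close>: lift a representing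
  cycle of the class \<open>S\<close> along \<open>j\<close>, apply the boundary of \<open>B\<close>, and pull the result back along
  \<open>i\<close>.  The set of all chains arising in this way from all representatives and all lifts is
  exactly one homology class of \<open>A\<close>.
\<close>

definition connecting ::
  "'a chain_complex \<Rightarrow> (int \<Rightarrow> 'a \<Rightarrow> 'b) \<Rightarrow> 'b chain_complex \<Rightarrow> (int \<Rightarrow> 'b \<Rightarrow> 'c) \<Rightarrow> int \<Rightarrow> 'c set \<Rightarrow> 'a set"
  where "connecting A i B j n S =
    {a \<in> carrier (chains A (n - 1)).
      \<exists>b \<in> carrier (chains B n). j n b \<in> S \<and> i (n - 1) a = bdry B n b}"

definition exact_at ::
  "('a, 'm) monoid_scheme \<Rightarrow> ('a \<Rightarrow> 'b) \<Rightarrow> ('b, 'n) monoid_scheme \<Rightarrow> ('b \<Rightarrow> 'c)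
    \<Rightarrow> ('c, 'k) monoid_scheme \<Rightarrow> bool"
  where "exact_at A f B g C \<longleftrightarrow>
    comm_group A \<and> comm_group B \<and> comm_group C \<and> f \<in> hom A B \<and> g \<in> hom B C \<and>
    f ` carrier A = kernel B C g"

text \<open>The square with rows \<open>f : A \<rightarrow> B\<close>, \<open>f' : A' \<rightarrow> B'\<close> and columns \<open>p : A \<rightarrow> A'\<close>, \<open>q : B \<rightarrow> B'\<close>.\<close>

definition commuting_square ::
  "('a, 'm1) monoid_scheme \<Rightarrow> ('a \<Rightarrow> 'b) \<Rightarrow> ('b, 'm2) monoid_scheme \<Rightarrow> ('a \<Rightarrow> 'c) \<Rightarrow> ('b \<Rightarrow> 'd)
    \<Rightarrow> ('c, 'm3) monoid_scheme \<Rightarrow> ('c \<Rightarrow> 'd) \<Rightarrow> ('d, 'm4) monoid_scheme \<Rightarrow> bool"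
  where "commuting_square A f B p q A' f' B' \<longleftrightarrow>
    f \<in> hom A B \<and> f' \<in> hom A' B' \<and> p \<in> hom A A' \<and> q \<in> hom B B' \<and>
    (\<forall>x \<in> carrier A. q (f x) = f' (p x))"


section \<open>The rack, degenerate and quandle complexes\<close>

text \<open>For \<open>n \<le> 0\<close> there are no tuples, so that all groups below are trivial in these degrees.\<close>

definition tuples :: "'a set \<Rightarrow> int \<Rightarrow> 'a list set"
  where "tuples X n = {xs. xs \<noteq> [] \<and> int (length xs) = n \<and> set xs \<subseteq> X}"

definition degenerate_tuples :: "'a set \<Rightarrow> int \<Rightarrow> 'a list set"
  where "degenerate_tuples X n =
    {xs \<in> tuples X n. \<exists>i. Suc i < length xs \<and> xs ! i = xs ! Suc i}"

definition rack_chains :: "'a set \<Rightarrow> int \<Rightarrow> ('a list \<Rightarrow>\<^sub>0 int) monoid"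
  where "rack_chains X n = free_Abelian_group (tuples X n)"

definition degenerate_chains :: "'a set \<Rightarrow> int \<Rightarrow> ('a list \<Rightarrow>\<^sub>0 int) monoid"
  where "degenerate_chains X n =
    subgroup_generated (rack_chains X n) (frag_of ` degenerate_tuples X n)"

text \<open>
  The summation index is the position counted from 1, so the \<open>i\<close>-th entry is \<open>xs ! (i - 1)\<close>.
  On 1-tuples the sum is empty.
\<close>

definition rack_boundary_tuple :: "('a \<Rightarrow> 'a \<Rightarrow> 'a) \<Rightarrow> 'a list \<Rightarrow> 'a list \<Rightarrow>\<^sub>0 int"
  where "rack_boundary_tuple s xs =
    (\<Sum>i = 2..length xs. frag_cmul ((-1) ^ i)
      (frag_of (take (i - 1) xs @ drop i xs) -
       frag_of (map (\<lambda>y. s y (xs ! (i - 1))) (take (i - 1) xs) @ drop i xs)))"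

definition rack_boundary :: "('a \<Rightarrow> 'a \<Rightarrow> 'a) \<Rightarrow> ('a list \<Rightarrow>\<^sub>0 int) \<Rightarrow> ('a list \<Rightarrow>\<^sub>0 int)"
  where "rack_boundary s = frag_extend (rack_boundary_tuple s)"

definition C_R :: "'a set \<Rightarrow> ('a \<Rightarrow> 'a \<Rightarrow> 'a) \<Rightarrow> ('a list \<Rightarrow>\<^sub>0 int) chain_complex"
  where "C_R X s = \<lparr>chains = rack_chains X, bdry = (\<lambda>n. rack_boundary s)\<rparr>"

definition C_D :: "'a set \<Rightarrow> ('a \<Rightarrow> 'a \<Rightarrow> 'a) \<Rightarrow> ('a list \<Rightarrow>\<^sub>0 int) chain_complex"
  where "C_D X s = \<lparr>chains = degenerate_chains X, bdry = (\<lambda>n. rack_boundary s)\<rparr>"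

definition C_Q :: "'a set \<Rightarrow> ('a \<Rightarrow> 'a \<Rightarrow> 'a) \<Rightarrow> ('a list \<Rightarrow>\<^sub>0 int) set chain_complex"
  where "C_Q X s =
    \<lparr>chains = (\<lambda>n. rack_chains X n Mod carrier (degenerate_chains X n)),
     bdry = (\<lambda>n. quot_map (rack_chains X (n - 1)) (carrier (degenerate_chains X (n - 1)))
                  (rack_boundary s))\<rparr>"

definition incl_chain :: "int \<Rightarrow> ('a list \<Rightarrow>\<^sub>0 int) \<Rightarrow> ('a list \<Rightarrow>\<^sub>0 int)"
  where "incl_chain n c = c"

definition proj_chain :: "'a set \<Rightarrow> int \<Rightarrow> ('a list \<Rightarrow>\<^sub>0 int) \<Rightarrow> ('a list \<Rightarrow>\<^sub>0 int) set"
  where "proj_chain X n c = carrier (degenerate_chains X n) #>\<^bsub>rack_chains X n\<^esub> c"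

definition map_chain :: "('a \<Rightarrow> 'b) \<Rightarrow> int \<Rightarrow> ('a list \<Rightarrow>\<^sub>0 int) \<Rightarrow> ('b list \<Rightarrow>\<^sub>0 int)"
  where "map_chain f n = frag_extend (\<lambda>xs. frag_of (map f xs))"

definition map_chain_Q ::
  "'b set \<Rightarrow> ('a \<Rightarrow> 'b) \<Rightarrow> int \<Rightarrow> ('a list \<Rightarrow>\<^sub>0 int) set \<Rightarrow> ('b list \<Rightarrow>\<^sub>0 int) set"
  where "map_chain_Q Y f n =
    quot_map (rack_chains Y n) (carrier (degenerate_chains Y n)) (map_chain f n)"


section \<open>Homology with coefficients\<close>

definition H_D where "H_D X s G n = homology (tensor_complex (C_D X s) G) n"
definition H_R where "H_R X s G n = homology (tensor_complex (C_R X s) G) n"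
definition H_Q where "H_Q X s G n = homology (tensor_complex (C_Q X s) G) n"

definition i_star where
  "i_star X s G n = homology_map (tensor_complex (C_R X s) G)
    (tensor_chain_map (C_R X s) G incl_chain) n"

definition j_star where
  "j_star X s G n = homology_map (tensor_complex (C_Q X s) G)
    (tensor_chain_map (C_Q X s) G (proj_chain X)) n"

definition bdry_star where
  "bdry_star X s G n = connecting
    (tensor_complex (C_D X s) G) (tensor_chain_map (C_R X s) G incl_chain)
    (tensor_complex (C_R X s) G) (tensor_chain_map (C_Q X s) G (proj_chain X)) n"

text \<open>
  \<open>f\<^sub>*\<close> for a quandle homomorphism \<open>f\<close>; it depends on its target \<open>Y\<close> (with operation \<open>t\<close>)
  only, because cosets are mapped to cosets by \<open>quot_map\<close>.
\<close>

definition star_D where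
  "star_D Y t G f n = homology_map (tensor_complex (C_D Y t) G)
    (tensor_chain_map (C_D Y t) G (map_chain f)) n"

definition star_R where
  "star_R Y t G f n = homology_map (tensor_complex (C_R Y t) G)
    (tensor_chain_map (C_R Y t) G (map_chain f)) n"

definition star_Q where
  "star_Q Y t G f n = homology_map (tensor_complex (C_Q Y t) G)
    (tensor_chain_map (C_Q Y t) G (map_chain_Q Y f)) n"

end

theory Submission
  imports Defs
begin

text \<open>
  As an abelian group, the rack chains split as the sum of the degenerate chains, which are free on
  the degenerate tuples, and a complement free on the remaining tuples.  Every additive functor
  preserves such a splitting, so tensoring with \<open>G\<close> keeps the sequence of complexes short exact,
  and the snake lemma gives the natural long exact sequence.

  That the rack, degenerate and quandle chains are complexes follows by induction from
  \<open>\<partial>(xs, y) = (\<partial>xs, y) + (-1)\<^sup>n (xs - xs * y)\<close> with \<open>n = length xs + 1\<close>: translation by \<open>y\<close> is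
  a quandle homomorphism and hence commutes with \<open>\<partial>\<close>, and if \<open>xs\<close> ends in \<open>y\<close>, then the two
  non-degenerate contributions cancel because of \<open>y * y = y\<close>.
\<close>

section \<open>Quotients of abelian groups\<close>

text \<open>Tensoring is only right exact, so the inclusion of the degenerate chains could stop
  being injective after tensoring. A splitting avoids this because it consists of equations between
  homomorphisms, and equations are preserved. It is chosen separately in each degree and is not
  asked to commute with the boundary; it serves only to give exactness degree by degree, and the
  connecting homomorphism is constructed without it.

  Tensor products and homology groups are literal quotients, so maps between them act on sets.
  \<open>tensor_hom_eqI\<close> reduces identities between tensor maps to pure tensors.
  \<open>connecting\<close> collects the results of all possible choices of representatives and
  lifts; its well-definedness is therefore the claim that the resulting set is a single homology
  class.\<close>

lemma rcos_eq_iff: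
  assumes "group B" "subgroup K B" "x \<in> carrier B" "y \<in> carrier B"
  shows "K #>\<^bsub>B\<^esub> x = K #>\<^bsub>B\<^esub> y \<longleftrightarrow> (\<exists>k\<in>K. x = k \<otimes>\<^bsub>B\<^esub> y)"
proof -
  interpret group B by fact
  have "K #>\<^bsub>B\<^esub> x = K #>\<^bsub>B\<^esub> y \<longleftrightarrow> x \<in> K #>\<^bsub>B\<^esub> y"
    using assms by (metis rcos_self repr_independence)
  then show ?thesis
    by (auto simp: r_coset_def)
qed

lemma quot_map_rcos:
  assumes "group A" "group B" "subgroup H A" "subgroup K B"
    and f: "f \<in> hom A B" "f ` H \<subseteq> K" and x: "x \<in> carrier A"
  shows "quot_map B K f (H #>\<^bsub>A\<^esub> x) = K #>\<^bsub>B\<^esub> f x"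
proof -
  interpret A: group A by fact
  have "K #>\<^bsub>B\<^esub> f y = K #>\<^bsub>B\<^esub> f x" if "y \<in> H #>\<^bsub>A\<^esub> x" for y
  proof -
    obtain h where h: "h \<in> H" "y = h \<otimes>\<^bsub>A\<^esub> x"
      using \<open>y \<in> H #>\<^bsub>A\<^esub> x\<close> by (auto simp: r_coset_def)
    then have y: "f y = f h \<otimes>\<^bsub>B\<^esub> f x" "y \<in> carrier A"
      using f x subgroup.mem_carrier[OF assms(3)] by (auto simp: hom_mult)
    then have "\<exists>k\<in>K. f y = k \<otimes>\<^bsub>B\<^esub> f x"
      using h f(2) by blast
    then show ?thesis
      using rcos_eq_iff[OF assms(2,4) hom_in_carrier[OF f(1) y(2)] hom_in_carrier[OF f(1) x]] by simp
  qed
  \<comment> \<open>The coset is nonempty, so the union in \<open>quot_map\<close> collapses to the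
    common value and not to the empty set.\<close>
  moreover have "x \<in> H #>\<^bsub>A\<^esub> x"
    using assms by (simp add: A.rcos_self)
  ultimately have "(\<lambda>y. K #>\<^bsub>B\<^esub> f y) ` (H #>\<^bsub>A\<^esub> x) = {K #>\<^bsub>B\<^esub> f x}"
    by blast
  then show ?thesis
    unfolding quot_map_def by simp
qed

lemma mult_Mod_rcos:
  assumes "comm_group B" "subgroup K B" "x \<in> carrier B" "y \<in> carrier B"
  shows "(K #>\<^bsub>B\<^esub> x) \<otimes>\<^bsub>B Mod K\<^esub> (K #>\<^bsub>B\<^esub> y) = K #>\<^bsub>B\<^esub> (x \<otimes>\<^bsub>B\<^esub> y)"
  unfolding mult_FactGroup
  by (rule normal.rcos_sum[OF comm_group.subgroup_imp_normal[OF assms(1,2)] assms(3,4)])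

lemma rcos_in_Mod: "x \<in> carrier B \<Longrightarrow> K #>\<^bsub>B\<^esub> x \<in> carrier (B Mod K)"
  by (simp add: carrier_FactGroup)

lemma quot_map_hom:
  assumes "comm_group A" "comm_group B" "subgroup H A" "subgroup K B"
    and f: "f \<in> hom A B" "f ` H \<subseteq> K"
  shows "quot_map B K f \<in> hom (A Mod H) (B Mod K)"
proof (rule homI)
  have gr: "group A" "group B"
    using assms by (auto simp: comm_group_def)
  note quot = quot_map_rcos[OF gr assms(3-6)]
  fix S assume S: "S \<in> carrier (A Mod H)"
  then obtain x where x: "x \<in> carrier A" "S = H #>\<^bsub>A\<^esub> x"
    by (auto simp: carrier_FactGroup)
  then show "quot_map B K f S \<in> carrier (B Mod K)"
    using rcos_in_Mod[OF hom_in_carrier[OF f(1) x(1)]] quot[OF x(1)] by simp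
  fix T assume "T \<in> carrier (A Mod H)"
  then obtain y where y: "y \<in> carrier A" "T = H #>\<^bsub>A\<^esub> y"
    by (auto simp: carrier_FactGroup)
  have "x \<otimes>\<^bsub>A\<^esub> y \<in> carrier A"
    using x y gr(1) by (simp add: group.is_monoid monoid.m_closed)
  then show "quot_map B K f (S \<otimes>\<^bsub>A Mod H\<^esub> T) = quot_map B K f S \<otimes>\<^bsub>B Mod K\<^esub> quot_map B K f T"
    unfolding x(2) y(2) mult_Mod_rcos[OF assms(1,3) x(1) y(1)]
      quot[OF x(1)] quot[OF y(1)] mult_Mod_rcos[OF assms(2,4) hom_in_carrier[OF f(1) x(1)]
        hom_in_carrier[OF f(1) y(1)]]
    by (simp only: quot hom_mult[OF f(1) x(1) y(1)])
qed

section \<open>Tensor products\<close>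

definition tensor_class ::
  "('a, 'm) monoid_scheme \<Rightarrow> ('g, 'k) monoid_scheme \<Rightarrow> ('a \<times> 'g \<Rightarrow>\<^sub>0 int) \<Rightarrow> ('a \<times> 'g \<Rightarrow>\<^sub>0 int) set"
  where "tensor_class A G c =
    tensor_rel A G #>\<^bsub>free_Abelian_group (carrier A \<times> carrier G)\<^esub> c"

definition pure_tensor ::
  "('a, 'm) monoid_scheme \<Rightarrow> ('g, 'k) monoid_scheme \<Rightarrow> 'a \<Rightarrow> 'g \<Rightarrow> ('a \<times> 'g \<Rightarrow>\<^sub>0 int) set"
  where "pure_tensor A G a g = tensor_class A G (frag_of (a, g))"

lemma keys_diff_subset:
  "Poly_Mapping.keys a \<subseteq> S \<Longrightarrow> Poly_Mapping.keys b \<subseteq> S \<Longrightarrow> Poly_Mapping.keys (a - b) \<subseteq> S"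
  for a :: "'a \<Rightarrow>\<^sub>0 int"
  using keys_diff[of a b] by blast

lemma subgroup_tensor_rel:
  assumes "group A" "group G"
  shows "subgroup (tensor_rel A G) (free_Abelian_group (carrier A \<times> carrier G))"
proof -
  interpret A: group A by fact
  interpret G: group G by fact
  show ?thesis
    unfolding tensor_rel_def
    by (rule group.generate_is_subgroup[OF group_free_Abelian_group])
      (safe; simp; intro keys_diff_subset; simp)
qed

lemma comm_group_tensor:
  assumes "group A" "group G"
  shows "comm_group (tensor A G)"
  unfolding tensor_def
  by (intro comm_group.abelian_FactGroup abelian_free_Abelian_group subgroup_tensor_rel assms)

lemma carrier_tensor:
  "carrier (tensor A G) = tensor_class A G ` carrier (free_Abelian_group (carrier A \<times> carrier G))"
  by (simp add: tensor_def carrier_FactGroup tensor_class_def[abs_def])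

lemma tensor_class_hom:
  assumes "group A" "group G"
  shows "tensor_class A G \<in> hom (free_Abelian_group (carrier A \<times> carrier G)) (tensor A G)"
  using mult_Mod_rcos[OF abelian_free_Abelian_group subgroup_tensor_rel[OF assms]]
  by (intro homI) (auto simp: tensor_class_def tensor_def rcos_in_Mod simp del: mult_FactGroup)

lemma pure_tensor_closed:
  "a \<in> carrier A \<Longrightarrow> g \<in> carrier G \<Longrightarrow> pure_tensor A G a g \<in> carrier (tensor A G)"
  by (auto simp: pure_tensor_def carrier_tensor)

lemma tensor_class_eqI:
  assumes "group A" "group G" "x - y \<in> tensor_rel A G"
    "Poly_Mapping.keys x \<subseteq> carrier A \<times> carrier G" "Poly_Mapping.keys y \<subseteq> carrier A \<times> carrier G"
  shows "tensor_class A G x = tensor_class A G y"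
  using rcos_eq_iff[OF group_free_Abelian_group subgroup_tensor_rel[OF assms(1,2)], of x y] assms(3-5)
  by (auto simp: tensor_class_def intro!: bexI[of _ "x - y"])

text \<open>A generator of the first kind in \<open>tensor_rel\<close>, read in the quotient. It is
  the source of additivity: through it \<open>tensor_map\<close> respects the zero map and sums of
  maps.\<close>

lemma pure_tensor_mult_left:
  assumes "group A" "group G" "a \<in> carrier A" "a' \<in> carrier A" "g \<in> carrier G"
  shows "pure_tensor A G (a \<otimes>\<^bsub>A\<^esub> a') g = pure_tensor A G a g \<otimes>\<^bsub>tensor A G\<^esub> pure_tensor A G a' g"
proof -
  have "tensor_class A G (frag_of (a \<otimes>\<^bsub>A\<^esub> a', g)) = tensor_class A G (frag_of (a, g) + frag_of (a', g))"
  proof (rule tensor_class_eqI)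
    show "frag_of (a \<otimes>\<^bsub>A\<^esub> a', g) - (frag_of (a, g) + frag_of (a', g)) \<in> tensor_rel A G"
      unfolding tensor_rel_def diff_diff_eq[symmetric] using assms by (intro generate.incl) blast
    show "Poly_Mapping.keys (frag_of (a, g) + frag_of (a', g)) \<subseteq> carrier A \<times> carrier G"
      using assms keys_add[of "frag_of (a, g)" "frag_of (a', g)"] by auto
  qed (use assms in \<open>auto simp: monoid.m_closed group.is_monoid\<close>)
  then show ?thesis
    using assms hom_mult[OF tensor_class_hom[OF assms(1,2)], of "frag_of (a, g)" "frag_of (a', g)"]
    by (simp add: pure_tensor_def)
qed

text \<open>Composed with \<open>tensor_class\<close>, both maps become homomorphisms out of a free
  abelian group, and the basis elements of that group represent exactly the pure tensors.\<close>

lemma tensor_hom_eqI: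
  assumes "group A" "group G" "group K" "h \<in> hom (tensor A G) K" "k \<in> hom (tensor A G) K"
    and eq: "\<And>a g. a \<in> carrier A \<Longrightarrow> g \<in> carrier G \<Longrightarrow> h (pure_tensor A G a g) = k (pure_tensor A G a g)"
    and u: "u \<in> carrier (tensor A G)"
  shows "h u = k u"
proof -
  let ?F = "free_Abelian_group (carrier A \<times> carrier G)"
  obtain c where c: "u = tensor_class A G c" "Poly_Mapping.keys c \<subseteq> carrier A \<times> carrier G"
    using u by (auto simp: carrier_tensor)
  have hom: "group_hom ?F K (h \<circ> tensor_class A G)" "group_hom ?F K (k \<circ> tensor_class A G)"
    using tensor_class_hom[OF assms(1,2)] assms
    by (auto intro!: group_hom.intro group_hom_axioms.intro hom_compose)
  from c(2) have "(h \<circ> tensor_class A G) c = (k \<circ> tensor_class A G) c"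
  proof (induction c rule: free_Abelian_group_induct[consumes 1, case_names zero diff one])
    case zero
    then show ?case
      using hom[THEN group_hom.hom_one] by simp
  next
    case (diff x y)
    \<comment> \<open>The induction closes under subtraction of chains, whereas \<open>K\<close> is
      written multiplicatively.\<close>
    have "f (x - y) = f x \<otimes>\<^bsub>K\<^esub> inv\<^bsub>K\<^esub> f y" if "group_hom ?F K f" for f
      using group_hom.hom_mult[OF that, of x "-y"] group_hom.hom_inv[OF that, of y] diff by simp
    with diff hom show ?case by metis
  next
    case (one a)
    then show ?case using eq by (auto simp: pure_tensor_def)
  qed
  with c show ?thesis by simp
qed

text \<open>Each generator goes to a generator of the same kind: additivity of \<open>f\<close>
  takes care of products in the first slot, and the second slot is left alone. This makes
  \<open>f \<otimes> id\<close> well defined on classes.\<close>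

lemma frag_extend_tensor_rel:
  assumes "group A" "group B" "group G" "f \<in> hom A B"
  shows "frag_extend (\<lambda>(a, g). frag_of (f a, g)) ` tensor_rel A G \<subseteq> tensor_rel B G"
proof -
  let ?f = "frag_extend (\<lambda>(a, g). frag_of (f a, g))"
  let ?gens = "\<lambda>K. {frag_of (a \<otimes>\<^bsub>K\<^esub> a', g) - frag_of (a, g) - frag_of (a', g) |a a' g.
        a \<in> carrier K \<and> a' \<in> carrier K \<and> g \<in> carrier G} \<union>
     {frag_of (a, g \<otimes>\<^bsub>G\<^esub> g') - frag_of (a, g) - frag_of (a, g') |a g g'.
        a \<in> carrier K \<and> g \<in> carrier G \<and> g' \<in> carrier G}"
  note sub = subgroup_tensor_rel[OF _ assms(3)]
  have fc: "f a \<in> carrier B" if "a \<in> carrier A" for a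
    using assms(4) that by (rule hom_in_carrier)
  have gen: "?f h \<in> tensor_rel B G" if "h \<in> ?gens A" for h
  proof -
    have "?f h \<in> ?gens B"
      using that
    proof (elim UnE CollectE exE conjE)
      fix a a' g
      assume *: "h = frag_of (a \<otimes>\<^bsub>A\<^esub> a', g) - frag_of (a, g) - frag_of (a', g)"
        and "a \<in> carrier A" "a' \<in> carrier A" "g \<in> carrier G"
      then show ?thesis
        by (intro UnI1 CollectI exI[of _ "f a"] exI[of _ "f a'"] exI[of _ g])
          (simp add: frag_extend_diff hom_mult[OF assms(4)] fc)
    next
      fix a g g'
      assume *: "h = frag_of (a, g \<otimes>\<^bsub>G\<^esub> g') - frag_of (a, g) - frag_of (a, g')"
        and "a \<in> carrier A" "g \<in> carrier G" "g' \<in> carrier G"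
      then show ?thesis
        by (intro UnI2 CollectI exI[of _ "f a"] exI[of _ g] exI[of _ g'])
          (simp add: frag_extend_diff fc)
    qed
    then show ?thesis
      unfolding tensor_rel_def by (rule generate.incl)
  qed
  have "?f c \<in> tensor_rel B G" if "c \<in> tensor_rel A G" for c
    using that unfolding tensor_rel_def[of A]
  proof (induction c rule: generate.induct)
    case one
    show ?case
      using subgroup.one_closed[OF sub[OF assms(2)]] by simp
  next
    case (incl h)
    then show ?case by (rule gen)
  next
    case (inv h)
    then have "h \<in> tensor_rel A G"
      unfolding tensor_rel_def by (rule generate.incl)
    \<comment> \<open>The group inverse is negation for chains supported on the basis, hence the
      bound on the support of \<open>h\<close>.\<close>
    then have keys: "Poly_Mapping.keys h \<subseteq> carrier A \<times> carrier G"
      using subgroup.mem_carrier[OF sub[OF assms(1)]] by simp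
    note img = gen[OF inv]
    show ?case
      using subgroup.m_inv_closed[OF sub[OF assms(2)] img] subgroup.mem_carrier[OF sub[OF assms(2)] img]
      by (simp add: frag_extend_minus keys)
  next
    case (eng h1 h2)
    then show ?case
      using subgroup.m_closed[OF sub[OF assms(2)]] by (simp add: frag_extend_add)
  qed
  then show ?thesis by blast
qed

lemma frag_extend_tensor_hom:
  assumes "f \<in> hom A B"
  shows "frag_extend (\<lambda>(a, g). frag_of (f a, g))
    \<in> hom (free_Abelian_group (carrier A \<times> carrier G)) (free_Abelian_group (carrier B \<times> carrier G))"
proof -
  have "Poly_Mapping.keys (frag_extend (\<lambda>(a, g). frag_of (f a, g)) c) \<subseteq> carrier B \<times> carrier G"
    if "Poly_Mapping.keys c \<subseteq> carrier A \<times> carrier G" for c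
    using that assms by (intro order_trans[OF keys_frag_extend]) (auto dest: hom_in_carrier)
  then show ?thesis
    by (intro homI) (auto simp: frag_extend_add)
qed

section \<open>Functoriality and additivity of the tensor product with a fixed group\<close>

lemma tensor_map_hom:
  assumes "group A" "group B" "group G" "f \<in> hom A B"
  shows "tensor_map B G f \<in> hom (tensor A G) (tensor B G)"
  unfolding tensor_map_def tensor_def
  by (intro quot_map_hom abelian_free_Abelian_group subgroup_tensor_rel frag_extend_tensor_hom
      frag_extend_tensor_rel assms)

lemma tensor_map_pure_tensor:
  assumes "group A" "group B" "group G" "f \<in> hom A B" "a \<in> carrier A" "g \<in> carrier G"
  shows "tensor_map B G f (pure_tensor A G a g) = pure_tensor B G (f a) g"
  unfolding tensor_map_def pure_tensor_def tensor_class_def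
  using assms
  by (subst quot_map_rcos) (auto intro!: subgroup_tensor_rel frag_extend_tensor_hom
      frag_extend_tensor_rel[THEN subsetD])

lemma tensor_map_ident:
  assumes "group A" "group G" "f \<in> hom A A" "\<And>a. a \<in> carrier A \<Longrightarrow> f a = a"
    and "u \<in> carrier (tensor A G)"
  shows "tensor_map A G f u = u"
proof (rule tensor_hom_eqI[OF assms(1,2) _ tensor_map_hom[OF assms(1,1,2,3)] _ _ assms(5)])
  show "group (tensor A G)"
    by (rule comm_group.axioms(2)[OF comm_group_tensor[OF assms(1,2)]])
  show "(\<lambda>x. x) \<in> hom (tensor A G) (tensor A G)"
    by (simp add: hom_def)
qed (use tensor_map_pure_tensor[OF assms(1,1,2,3)] assms(4) in simp)

text \<open>The composite enters as a separate map \<open>k\<close> that has to agree with it on the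
  carrier only. One statement thus covers honest composites, one-sided inverses (\<open>k\<close>
  the identity) and the square of the boundary (\<open>k\<close> constant).\<close>

lemma tensor_map_comp:
  assumes "group A" "group B" "group C" "group G" "f \<in> hom A B" "g \<in> hom B C" "k \<in> hom A C"
    and "\<And>a. a \<in> carrier A \<Longrightarrow> g (f a) = k a"
    and "u \<in> carrier (tensor A G)"
  shows "tensor_map C G g (tensor_map B G f u) = tensor_map C G k u"
proof -
  note TC = comm_group.axioms(2)[OF comm_group_tensor[OF assms(3,4)]]
  have "(tensor_map C G g \<circ> tensor_map B G f) u = tensor_map C G k u"
  proof (rule tensor_hom_eqI[OF assms(1,4) TC _ _ _ assms(9)])
    show "tensor_map C G g \<circ> tensor_map B G f \<in> hom (tensor A G) (tensor C G)"
      by (rule hom_compose[OF tensor_map_hom[OF assms(1,2,4,5)] tensor_map_hom[OF assms(2,3,4,6)]])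
    show "tensor_map C G k \<in> hom (tensor A G) (tensor C G)"
      by (rule tensor_map_hom[OF assms(1,3,4,7)])
    fix a h assume a: "a \<in> carrier A" and h: "h \<in> carrier G"
    show "(tensor_map C G g \<circ> tensor_map B G f) (pure_tensor A G a h)
        = tensor_map C G k (pure_tensor A G a h)"
      using tensor_map_pure_tensor[OF assms(1,2,4,5) a h] tensor_map_pure_tensor[OF assms(1,3,4,7) a h]
        tensor_map_pure_tensor[OF assms(2,3,4,6) hom_in_carrier[OF assms(5) a] h] assms(8)[OF a]
      by simp
  qed
  then show ?thesis by simp
qed

lemma tensor_map_commute:
  assumes "group A" "group B" "group B'" "group C" "group G"
    and "f \<in> hom A B" "g \<in> hom B C" "f' \<in> hom A B'" "g' \<in> hom B' C"
    and "\<And>a. a \<in> carrier A \<Longrightarrow> g (f a) = g' (f' a)"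
    and "u \<in> carrier (tensor A G)"
  shows "tensor_map C G g (tensor_map B G f u) = tensor_map C G g' (tensor_map B' G f' u)"
proof -
  have k: "g' \<circ> f' \<in> hom A C"
    using assms by (auto intro: hom_compose)
  have "tensor_map C G g (tensor_map B G f u) = tensor_map C G (g' \<circ> f') u"
    by (intro tensor_map_comp[of A B C]) (use assms k in auto)
  also have "\<dots> = tensor_map C G g' (tensor_map B' G f' u)"
    by (rule tensor_map_comp[of A B' C, symmetric]) (use assms k in auto)
  finally show ?thesis .
qed

lemma tensor_map_trivial:
  assumes "group A" "group B" "group G" "f \<in> hom A B" "\<And>a. a \<in> carrier A \<Longrightarrow> f a = \<one>\<^bsub>B\<^esub>"
    and "u \<in> carrier (tensor A G)"
  shows "tensor_map B G f u = \<one>\<^bsub>tensor B G\<^esub>"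
proof -
  interpret T: comm_group "tensor B G"
    using assms(2,3) by (rule comm_group_tensor)
  interpret B: group B by fact
  \<comment> \<open>The element is idempotent, since the unit of \<open>B\<close> is the product of
    two units; in a group this forces it to be the unit.\<close>
  have one: "pure_tensor B G \<one>\<^bsub>B\<^esub> g = \<one>\<^bsub>tensor B G\<^esub>" if "g \<in> carrier G" for g
    using pure_tensor_mult_left[OF assms(2,3), of "\<one>\<^bsub>B\<^esub>" "\<one>\<^bsub>B\<^esub>" g]
      pure_tensor_closed[of "\<one>\<^bsub>B\<^esub>" B g G] that
    by simp
  show ?thesis
  proof (rule tensor_hom_eqI[OF assms(1,3) T.is_group tensor_map_hom[OF assms(1-4)] _ _ assms(6)])
    show "(\<lambda>x. \<one>\<^bsub>tensor B G\<^esub>) \<in> hom (tensor A G) (tensor B G)"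
      by (simp add: hom_def)
  qed (use tensor_map_pure_tensor[OF assms(1-4)] assms(5) one in simp)
qed

text \<open>Both sides are homomorphisms, the right-hand one because the target is commutative, and
  on a pure tensor the claim is linearity in the first slot. This additivity carries the
  decomposition \<open>ir_sj\<close> over to tensor products.\<close>

lemma tensor_map_mult:
  assumes "group A" "group B" "group G" "f \<in> hom A B" "g \<in> hom A B" "k \<in> hom A B"
    and "\<And>a. a \<in> carrier A \<Longrightarrow> k a = f a \<otimes>\<^bsub>B\<^esub> g a"
    and "u \<in> carrier (tensor A G)"
  shows "tensor_map B G k u = tensor_map B G f u \<otimes>\<^bsub>tensor B G\<^esub> tensor_map B G g u"
proof -
  interpret T: comm_group "tensor B G"
    using assms(2,3) by (rule comm_group_tensor)
  note pure = tensor_map_pure_tensor[OF assms(1-3)]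
  show ?thesis
  proof (rule tensor_hom_eqI[OF assms(1,3) T.is_group tensor_map_hom[OF assms(1-3,6)] _ _ assms(8)])
    show "(\<lambda>x. tensor_map B G f x \<otimes>\<^bsub>tensor B G\<^esub> tensor_map B G g x) \<in> hom (tensor A G) (tensor B G)"
      by (intro T.hom_group_mult tensor_map_hom[OF assms(1-3)] assms(4,5)
          comm_group.axioms(2)[OF comm_group_tensor[OF assms(1,3)]])
    fix a h assume a: "a \<in> carrier A" and h: "h \<in> carrier G"
    show "tensor_map B G k (pure_tensor A G a h) = tensor_map B G f (pure_tensor A G a h)
        \<otimes>\<^bsub>tensor B G\<^esub> tensor_map B G g (pure_tensor A G a h)"
      using pure_tensor_mult_left[OF assms(2,3) hom_in_carrier[OF assms(4) a] hom_in_carrier[OF assms(5) a] h]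
      by (simp add: pure[OF _ a h] assms(4-7) a)
  qed
qed

text \<open>A short exact sequence with a splitting, encoded by equations between homomorphisms in
  place of injectivity, surjectivity and a kernel condition. Equations pass through
  \<open>tensor_map\<close>; exactness is read off from them afterwards.\<close>

locale split_exact =
  A: comm_group A + B: comm_group B + C: comm_group C
  for A :: "('a, 'm) monoid_scheme" and B :: "('b, 'n) monoid_scheme" and C :: "('c, 'k) monoid_scheme" +
  fixes i :: "'a \<Rightarrow> 'b" and j :: "'b \<Rightarrow> 'c" and r :: "'b \<Rightarrow> 'a" and s :: "'c \<Rightarrow> 'b"
  assumes i_hom: "i \<in> hom A B" and j_hom: "j \<in> hom B C"
    and r_hom: "r \<in> hom B A" and s_hom: "s \<in> hom C B"
    and ri: "a \<in> carrier A \<Longrightarrow> r (i a) = a"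
    and js: "c \<in> carrier C \<Longrightarrow> j (s c) = c"
    and ir_sj: "b \<in> carrier B \<Longrightarrow> i (r b) \<otimes>\<^bsub>B\<^esub> s (j b) = b"
begin

text \<open>Decompose \<open>i a\<close> by \<open>ir_sj\<close>: since \<open>r (i a) = a\<close>,
  the factor \<open>s (j (i a))\<close> must be trivial, and \<open>j\<close> undoes
  \<open>s\<close>.\<close>

lemma ji:
  assumes "a \<in> carrier A"
  shows "j (i a) = \<one>\<^bsub>C\<^esub>"
proof -
  have c: "i a \<in> carrier B" "j (i a) \<in> carrier C" "s (j (i a)) \<in> carrier B"
    using assms i_hom j_hom s_hom by (auto intro: hom_in_carrier)
  have "i a \<otimes>\<^bsub>B\<^esub> s (j (i a)) = i a"
    using ir_sj[of "i a"] assms c by (simp add: ri)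
  then have "s (j (i a)) = \<one>\<^bsub>B\<^esub>"
    using c by simp
  then show ?thesis
    using js[of "j (i a)"] c hom_one[OF j_hom] by simp
qed

lemma inj: "inj_on i (carrier A)"
  by (metis ri inj_onI)

lemma surj: "j ` carrier B = carrier C"
  using js j_hom s_hom by (force dest: hom_in_carrier)

text \<open>The retraction supplies preimages: for \<open>b\<close> in the kernel of
  \<open>j\<close> the decomposition collapses to \<open>i (r b) = b\<close>.\<close>

lemma exact: "i ` carrier A = kernel B C j"
proof
  show "i ` carrier A \<subseteq> kernel B C j"
    using ji hom_in_carrier[OF i_hom] by (auto simp: kernel_def)
  show "kernel B C j \<subseteq> i ` carrier A"
  proof
    fix b assume "b \<in> kernel B C j"
    then have b: "b \<in> carrier B" "j b = \<one>\<^bsub>C\<^esub>" by (auto simp: kernel_def)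
    have ra: "r b \<in> carrier A" using b hom_in_carrier[OF r_hom] by auto
    then have "i (r b) = b"
      using ir_sj[of b] b hom_one[OF s_hom] hom_in_carrier[OF i_hom ra] by simp
    with ra show "b \<in> i ` carrier A" by force
  qed
qed

text \<open>The one-sided inverse laws need functoriality only. The decomposition
  \<open>ir_sj\<close> is a product of two composites and needs additivity as well.\<close>

lemma tensor:
  assumes "group G"
  shows "split_exact (tensor A G) (tensor B G) (tensor C G)
    (tensor_map B G i) (tensor_map C G j) (tensor_map A G r) (tensor_map B G s)"
proof -
  note hom = i_hom j_hom r_hom s_hom
  have ident: "(\<lambda>x. x) \<in> hom K K" for K :: "('x, 'y) monoid_scheme"
    by (simp add: hom_def)
  have comp: "(\<lambda>x. i (r x)) \<in> hom B B" "(\<lambda>x. s (j x)) \<in> hom B B"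
    using hom hom_compose[of r B A i B] hom_compose[of j B C s B] by (auto simp: o_def)
  note gr = A.is_group B.is_group C.is_group assms
  show ?thesis
  proof (intro split_exact.intro split_exact_axioms.intro comm_group_tensor tensor_map_hom gr hom)
    fix u assume u: "u \<in> carrier (tensor A G)"
    show "tensor_map A G r (tensor_map B G i u) = u"
      using u tensor_map_comp[OF gr(1,2,1,4) hom(1,3) ident] tensor_map_ident[OF gr(1,4) ident] ri
      by simp
  next
    fix u assume u: "u \<in> carrier (tensor C G)"
    show "tensor_map C G j (tensor_map B G s u) = u"
      using u tensor_map_comp[OF gr(3,2,3,4) hom(4,2) ident] tensor_map_ident[OF gr(3,4) ident] js
      by simp
  next
    fix u assume u: "u \<in> carrier (tensor B G)"
    have "tensor_map B G i (tensor_map A G r u) = tensor_map B G (\<lambda>x. i (r x)) u"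
      by (rule tensor_map_comp[OF gr(2,1,2,4) hom(3,1) comp(1) _ u]) simp
    moreover have "tensor_map B G s (tensor_map C G j u) = tensor_map B G (\<lambda>x. s (j x)) u"
      by (rule tensor_map_comp[OF gr(2,3,2,4) hom(2,4) comp(2) _ u]) simp
    moreover have "tensor_map B G (\<lambda>x. x) u = u"
      using u by (intro tensor_map_ident gr ident) auto
    moreover have "tensor_map B G (\<lambda>x. x) u =
        tensor_map B G (\<lambda>x. i (r x)) u \<otimes>\<^bsub>tensor B G\<^esub> tensor_map B G (\<lambda>x. s (j x)) u"
      using u ir_sj by (intro tensor_map_mult[of B B] gr comp ident) auto
    ultimately show "tensor_map B G i (tensor_map A G r u) \<otimes>\<^bsub>tensor B G\<^esub>
        tensor_map B G s (tensor_map C G j u) = u"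
      by simp
  qed
qed

end

section \<open>The long exact homology sequence\<close>

definition cycles :: "'c chain_complex \<Rightarrow> int \<Rightarrow> 'c set"
  where "cycles C n = kernel (chains C n) (chains C (n - 1)) (bdry C n)"

definition homology_class :: "'c chain_complex \<Rightarrow> int \<Rightarrow> 'c \<Rightarrow> 'c set"
  where "homology_class C n z = boundaries C n #>\<^bsub>cycle_group C n\<^esub> z"

locale ab_complex =
  fixes C :: "'c chain_complex"
  assumes comm: "comm_group (chains C n)"
    and bdry_hom: "bdry C n \<in> hom (chains C n) (chains C (n - 1))"
    and bdry_bdry: "c \<in> carrier (chains C (n + 1)) \<Longrightarrow> bdry C n (bdry C (n + 1) c) = \<one>\<^bsub>chains C (n - 1)\<^esub>"
begin

sublocale ch: comm_group "chains C n" for n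
  by (rule comm)

sublocale bd: group_hom "chains C n" "chains C (n - 1)" "bdry C n" for n
  by (intro group_hom.intro group_hom_axioms.intro bdry_hom ch.is_group)

lemma bdry_closed [simp]: "c \<in> carrier (chains C (n + 1)) \<Longrightarrow> bdry C (n + 1) c \<in> carrier (chains C n)"
  using bd.hom_closed[of c "n + 1"] by simp

lemma mem_cycles: "z \<in> cycles C n \<longleftrightarrow> z \<in> carrier (chains C n) \<and> bdry C n z = \<one>\<^bsub>chains C (n - 1)\<^esub>"
  by (simp add: cycles_def kernel_def)

lemma subgroup_cycles: "subgroup (cycles C n) (chains C n)"
  unfolding cycles_def by (rule bd.subgroup_kernel)

text \<open>The kernel is already a subgroup, so \<open>subgroup_generated\<close> adds no
  elements.\<close>

lemma carrier_cycle_group [simp]: "carrier (cycle_group C n) = cycles C n"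
  unfolding cycle_group_def cycles_def[symmetric]
  by (rule subgroup.carrier_subgroup_generated_subgroup[OF subgroup_cycles])

lemma mult_cycle_group [simp]: "x \<otimes>\<^bsub>cycle_group C n\<^esub> y = x \<otimes>\<^bsub>chains C n\<^esub> y"
  by (simp add: cycle_group_def)

lemma one_cycle_group [simp]: "\<one>\<^bsub>cycle_group C n\<^esub> = \<one>\<^bsub>chains C n\<^esub>"
  by (simp add: cycle_group_def)

lemma comm_group_cycle_group: "comm_group (cycle_group C n)"
  unfolding cycle_group_def by (rule ch.abelian_subgroup_generated[OF comm])

lemma boundaries_iff: "z \<in> boundaries C n \<longleftrightarrow> (\<exists>c\<in>carrier (chains C (n + 1)). z = bdry C (n + 1) c)"
  by (auto simp: boundaries_def)

lemma subgroup_boundaries: "subgroup (boundaries C n) (cycle_group C n)"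
proof -
  have "subgroup (boundaries C n) (chains C n)"
    using bd.img_is_subgroup[of "n + 1"] by (simp add: boundaries_def)
  moreover have "boundaries C n \<subseteq> cycles C n"
    by (auto simp: boundaries_iff mem_cycles bdry_bdry)
  ultimately show ?thesis
    unfolding cycle_group_def cycles_def[symmetric]
    using subgroup_cycles ch.subgroup_subgroup_generated_iff
    by (metis carrier_cycle_group cycle_group_def cycles_def)
qed

lemma comm_group_homology: "comm_group (homology C n)"
  unfolding homology_def
  by (rule comm_group.abelian_FactGroup[OF comm_group_cycle_group subgroup_boundaries])

lemma carrier_homology: "carrier (homology C n) = homology_class C n ` cycles C n"
  by (simp add: homology_def carrier_FactGroup homology_class_def[abs_def])

lemma homology_class_closed: "z \<in> cycles C n \<Longrightarrow> homology_class C n z \<in> carrier (homology C n)"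
  by (simp add: carrier_homology)

lemma homology_class_eq_iff:
  assumes "z \<in> cycles C n" "z' \<in> cycles C n"
  shows "homology_class C n z = homology_class C n z' \<longleftrightarrow>
    (\<exists>c\<in>carrier (chains C (n + 1)). z = bdry C (n + 1) c \<otimes>\<^bsub>chains C n\<^esub> z')"
  unfolding homology_class_def
  using rcos_eq_iff[OF comm_group.axioms(2)[OF comm_group_cycle_group] subgroup_boundaries, of z n z'] assms
  by (auto simp: boundaries_def)

text \<open>Classes are described by their elements because \<open>connecting\<close> is defined
  through elements of a class.\<close>

lemma mem_homology_class:
  "w \<in> homology_class C n z \<longleftrightarrow> (\<exists>c\<in>carrier (chains C (n + 1)). w = bdry C (n + 1) c \<otimes>\<^bsub>chains C n\<^esub> z)"
  by (auto simp: homology_class_def r_coset_def boundaries_def)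

lemma one_in_cycles [simp]: "\<one>\<^bsub>chains C n\<^esub> \<in> cycles C n"
  by (simp add: mem_cycles)

lemma mult_in_cycles [simp]: "z \<in> cycles C n \<Longrightarrow> w \<in> cycles C n \<Longrightarrow> z \<otimes>\<^bsub>chains C n\<^esub> w \<in> cycles C n"
  by (simp add: mem_cycles)

lemma one_homology: "\<one>\<^bsub>homology C n\<^esub> = homology_class C n \<one>\<^bsub>chains C n\<^esub>"
  using group.coset_join2[OF comm_group.axioms(2)[OF comm_group_cycle_group] _ subgroup_boundaries, of "\<one>\<^bsub>chains C n\<^esub>" n]
    subgroup.one_closed[OF subgroup_boundaries, of n]
  by (simp add: homology_def homology_class_def)

lemma homology_class_one_iff:
  assumes "z \<in> cycles C n"
  shows "homology_class C n z = \<one>\<^bsub>homology C n\<^esub> \<longleftrightarrow> (\<exists>c\<in>carrier (chains C (n + 1)). z = bdry C (n + 1) c)"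
  by (simp add: one_homology homology_class_eq_iff assms)

lemma mult_homology_class:
  assumes "z \<in> cycles C n" "w \<in> cycles C n"
  shows "homology_class C n z \<otimes>\<^bsub>homology C n\<^esub> homology_class C n w = homology_class C n (z \<otimes>\<^bsub>chains C n\<^esub> w)"
  using mult_Mod_rcos[OF comm_group_cycle_group subgroup_boundaries, of z n w] assms
  by (simp add: homology_def homology_class_def)

end

section \<open>Chain maps and the induced maps on homology\<close>

locale chain_hom = C: ab_complex C + D: ab_complex D
  for C :: "'c chain_complex" and D :: "'d chain_complex" +
  fixes \<phi> :: "int \<Rightarrow> 'c \<Rightarrow> 'd"
  assumes hom: "\<phi> n \<in> hom (chains C n) (chains D n)"
    and bdry_commute: "c \<in> carrier (chains C n) \<Longrightarrow> bdry D n (\<phi> n c) = \<phi> (n - 1) (bdry C n c)"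
begin

sublocale map: group_hom "chains C n" "chains D n" "\<phi> n" for n
  by (intro group_hom.intro group_hom_axioms.intro hom C.ch.is_group D.ch.is_group)

lemma maps_cycles [simp]: "z \<in> cycles C n \<Longrightarrow> \<phi> n z \<in> cycles D n"
  by (simp add: C.mem_cycles D.mem_cycles bdry_commute)

lemma maps_cycles_hom: "\<phi> n \<in> hom (cycle_group C n) (cycle_group D n)"
  by (intro homI) (auto simp: C.mem_cycles)

lemma maps_boundaries: "\<phi> n ` boundaries C n \<subseteq> boundaries D n"
proof -
  have "\<phi> n (bdry C (n + 1) c) = bdry D (n + 1) (\<phi> (n + 1) c)"
    if "c \<in> carrier (chains C (n + 1))" for c
    using bdry_commute[OF that] by simp
  then show ?thesis
    by (force simp: boundaries_def)
qed

lemma homology_map_class: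
  "z \<in> cycles C n \<Longrightarrow> homology_map D \<phi> n (homology_class C n z) = homology_class D n (\<phi> n z)"
  unfolding homology_map_def homology_class_def
  by (rule quot_map_rcos[OF comm_group.axioms(2)[OF C.comm_group_cycle_group]
        comm_group.axioms(2)[OF D.comm_group_cycle_group] C.subgroup_boundaries
        D.subgroup_boundaries maps_cycles_hom maps_boundaries]) simp

lemma homology_map_hom: "homology_map D \<phi> n \<in> hom (homology C n) (homology D n)"
  unfolding homology_map_def homology_def
  by (rule quot_map_hom[OF C.comm_group_cycle_group D.comm_group_cycle_group C.subgroup_boundaries
        D.subgroup_boundaries maps_cycles_hom maps_boundaries])

end

section \<open>The snake lemma: the connecting homomorphism and exactness at the three
  places\<close>

locale short_exact = i: chain_hom A B i + j: chain_hom B C j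
  for A :: "'a chain_complex" and B :: "'b chain_complex" and C :: "'c chain_complex"
    and i :: "int \<Rightarrow> 'a \<Rightarrow> 'b" and j :: "int \<Rightarrow> 'b \<Rightarrow> 'c" +
  assumes inj: "inj_on (i n) (carrier (chains A n))"
    and surj: "j n ` carrier (chains B n) = carrier (chains C n)"
    and exact: "i n ` carrier (chains A n) = kernel (chains B n) (chains C n) (j n)"
begin

lemma ji [simp]: "a \<in> carrier (chains A n) \<Longrightarrow> j n (i n a) = \<one>\<^bsub>chains C n\<^esub>"
  using exact[of n] by (auto simp: kernel_def)

lemma j_lift: "c \<in> carrier (chains C n) \<Longrightarrow> \<exists>b\<in>carrier (chains B n). j n b = c"
  unfolding surj[symmetric] by blast

lemma i_lift: "b \<in> carrier (chains B n) \<Longrightarrow> j n b = \<one>\<^bsub>chains C n\<^esub> \<Longrightarrow> \<exists>a\<in>carrier (chains A n). i n a = b"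
  using equalityD2[OF exact[of n]] unfolding kernel_def by blast

lemma i_eqD: "i n a = i n a' \<Longrightarrow> a \<in> carrier (chains A n) \<Longrightarrow> a' \<in> carrier (chains A n) \<Longrightarrow> a = a'"
  using inj[of n] by (rule inj_onD)

lemma i_eq_oneD: "i n a = \<one>\<^bsub>chains B n\<^esub> \<Longrightarrow> a \<in> carrier (chains A n) \<Longrightarrow> a = \<one>\<^bsub>chains A n\<^esub>"
  using i_eqD[of n a "\<one>\<^bsub>chains A n\<^esub>"] i.map.hom_one[of n] i.C.ch.one_closed[of n] by argo

text \<open>The boundary of \<open>a\<close> is sent to the unit by \<open>i\<close>, which is
  injective one degree lower as well.\<close>

lemma cycle_if_i_cycle:
  assumes "i n a \<in> cycles B n" "a \<in> carrier (chains A n)"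
  shows "a \<in> cycles A n"
proof -
  have "i (n - 1) (bdry A n a) = \<one>\<^bsub>chains B (n - 1)\<^esub>"
    using assms(1) unfolding i.D.mem_cycles i.bdry_commute[OF assms(2)] by (rule conjunct2)
  then show ?thesis
    using i_eq_oneD[OF _ i.C.bd.hom_closed[OF assms(2)]] assms(2) unfolding i.C.mem_cycles by blast
qed

text \<open>One run of the snake construction: lift \<open>z\<close> to \<open>b\<close>, take the
  boundary, pull it back to \<open>a\<close>. It is a relation because the lift \<open>b\<close> is
  a choice; \<open>b\<close> then determines \<open>a\<close>, as \<open>i\<close> is
  injective.\<close>

definition zigzag :: "int \<Rightarrow> 'c \<Rightarrow> 'b \<Rightarrow> 'a \<Rightarrow> bool"
  where "zigzag n z b a \<longleftrightarrow> b \<in> carrier (chains B n) \<and> a \<in> carrier (chains A (n - 1)) \<and>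
    z = j n b \<and> i (n - 1) a = bdry B n b"

lemma bdry_bdry_pred:
  assumes "b \<in> carrier (chains B n)"
  shows "bdry B (n - 1) (bdry B n b) = \<one>\<^bsub>chains B (n - 2)\<^esub>"
  using i.D.bdry_bdry[of b "n - 1"] assms by simp

lemma zigzag_cycle: "zigzag n z b a \<Longrightarrow> a \<in> cycles A (n - 1)"
  unfolding zigzag_def by (intro cycle_if_i_cycle) (auto simp: i.D.mem_cycles bdry_bdry_pred)

text \<open>Any lift of a cycle has a boundary that \<open>j\<close> kills, and by exactness this
  boundary comes from \<open>A\<close>.\<close>

lemma zigzag_exists:
  assumes "z \<in> cycles C n"
  shows "\<exists>b a. zigzag n z b a"
proof -
  obtain b where b: "b \<in> carrier (chains B n)" "j n b = z"
    using j_lift assms by (auto simp: j.D.mem_cycles)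
  then have "j (n - 1) (bdry B n b) = \<one>\<^bsub>chains C (n - 1)\<^esub>"
    using assms j.bdry_commute[OF b(1)] by (simp add: j.D.mem_cycles)
  with b show ?thesis
    using i_lift[of "bdry B n b" "n - 1"] by (auto simp: zigzag_def)
qed

text \<open>The boundary of \<open>z\<close> is \<open>j\<close> applied to the boundary of
  \<open>b\<close>, hence \<open>j\<close> of \<open>i a\<close>, which is trivial. This provides
  cycles in \<open>C\<close> when the zigzag is built backwards from \<open>a\<close> and
  \<open>b\<close>.\<close>

lemma zigzag_start_cycle: "zigzag n z b a \<Longrightarrow> z \<in> cycles C n"
  unfolding zigzag_def using ji[of a "n - 1"] by (auto simp: j.D.mem_cycles j.bdry_commute)

text \<open>Independence of all choices, in both directions. Another representative changes the lift
  by a boundary, which is invisible after taking boundaries again; another lift changes it by some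
  \<open>i d\<close>, which moves \<open>a\<close> by the boundary of \<open>d\<close>. Conversely
  every such move is realised by adding \<open>i d\<close> to the lift.\<close>

lemma connecting_class:
  assumes "zigzag n z b a"
  shows "connecting A i B j n (homology_class C n z) = homology_class A (n - 1) a"
proof -
  have b: "b \<in> carrier (chains B n)" "z = j n b" and a: "a \<in> carrier (chains A (n - 1))"
    "i (n - 1) a = bdry B n b"
    using assms by (auto simp: zigzag_def)
  show ?thesis
  proof (intro equalityI subsetI)
    fix w assume "w \<in> connecting A i B j n (homology_class C n z)"
    then obtain v c where w: "w \<in> carrier (chains A (n - 1))" "i (n - 1) w = bdry B n v"
      and v: "v \<in> carrier (chains B n)" "j n v = bdry C (n + 1) c \<otimes>\<^bsub>chains C n\<^esub> z"
      and "c \<in> carrier (chains C (n + 1))"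
      unfolding connecting_def j.D.mem_homology_class by blast
    then obtain u where u: "u \<in> carrier (chains B (n + 1))" "c = j (n + 1) u"
      using j_lift by metis
    \<comment> \<open>The discrepancy between the lifts \<open>v\<close> and \<open>b\<close> once
      \<open>bdry B (n + 1) u\<close> has absorbed the change of representative; \<open>j\<close>
      kills it, so it comes from some \<open>d\<close>.\<close>
    let ?x = "v \<otimes>\<^bsub>chains B n\<^esub> inv\<^bsub>chains B n\<^esub> (bdry B (n + 1) u \<otimes>\<^bsub>chains B n\<^esub> b)"
    have "j n ?x = \<one>\<^bsub>chains C n\<^esub>"
      using u v b j.bdry_commute[OF u(1)] by simp
    then obtain d where d: "d \<in> carrier (chains A n)" "i n d = ?x"
      using i_lift[of ?x n] u v b by auto
    have "i n d \<otimes>\<^bsub>chains B n\<^esub> (bdry B (n + 1) u \<otimes>\<^bsub>chains B n\<^esub> b) = v"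
      unfolding d(2) using u v b by (simp add: i.D.ch.m_assoc)
    then have "bdry B n v = bdry B n (i n d \<otimes>\<^bsub>chains B n\<^esub> (bdry B (n + 1) u \<otimes>\<^bsub>chains B n\<^esub> b))"
      by simp
    also have "\<dots> = bdry B n (i n d) \<otimes>\<^bsub>chains B (n - 1)\<^esub> bdry B n b"
      using u(1) b(1) d(1) by (simp add: i.D.bdry_bdry del: i.bdry_commute)
    finally have "bdry B n v = bdry B n (i n d) \<otimes>\<^bsub>chains B (n - 1)\<^esub> bdry B n b" .
    then have "i (n - 1) w = i (n - 1) (bdry A n d \<otimes>\<^bsub>chains A (n - 1)\<^esub> a)"
      using w a d(1) by (simp add: i.bdry_commute)
    then have "w = bdry A n d \<otimes>\<^bsub>chains A (n - 1)\<^esub> a"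
      using w a d(1) by (intro i_eqD) auto
    with d(1) show "w \<in> homology_class A (n - 1) a"
      by (auto simp: i.C.mem_homology_class)
  next
    fix w assume "w \<in> homology_class A (n - 1) a"
    then obtain d where d: "d \<in> carrier (chains A n)" "w = bdry A n d \<otimes>\<^bsub>chains A (n - 1)\<^esub> a"
      by (auto simp: i.C.mem_homology_class)
    let ?v = "i n d \<otimes>\<^bsub>chains B n\<^esub> b"
    \<comment> \<open>The factor \<open>i n d\<close> is invisible to \<open>j\<close>, so
      \<open>?v\<close> still lifts \<open>z\<close> itself; the bounding chain required by
      membership in the class is the unit.\<close>
    have "j n ?v = bdry C (n + 1) \<one>\<^bsub>chains C (n + 1)\<^esub> \<otimes>\<^bsub>chains C n\<^esub> z"
      using d(1) b by simp
    then have "j n ?v \<in> homology_class C n z"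
      using j.D.mem_homology_class by blast
    moreover have "i (n - 1) w = bdry B n ?v"
      using d a b by (simp add: i.bdry_commute)
    moreover have "w \<in> carrier (chains A (n - 1))" "?v \<in> carrier (chains B n)"
      using d a b by auto
    ultimately show "w \<in> connecting A i B j n (homology_class C n z)"
      unfolding connecting_def by blast
  qed
qed

lemma zigzag_mult:
  assumes "zigzag n z b a" "zigzag n z' b' a'"
  shows "zigzag n (z \<otimes>\<^bsub>chains C n\<^esub> z') (b \<otimes>\<^bsub>chains B n\<^esub> b') (a \<otimes>\<^bsub>chains A (n - 1)\<^esub> a')"
  using assms by (auto simp: zigzag_def)

text \<open>Zigzags multiply componentwise, so the product of two chosen zigzags computes the value
  on the product of the classes.\<close>

lemma connecting_hom: "connecting A i B j n \<in> hom (homology C n) (homology A (n - 1))"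
proof (rule homI)
  fix S assume "S \<in> carrier (homology C n)"
  then obtain z b a where S: "S = homology_class C n z" "z \<in> cycles C n" "zigzag n z b a"
    using zigzag_exists by (metis imageE j.D.carrier_homology)
  then show "connecting A i B j n S \<in> carrier (homology A (n - 1))"
    using i.C.homology_class_closed[OF zigzag_cycle] by (simp add: connecting_class)
  fix T assume "T \<in> carrier (homology C n)"
  then obtain z' b' a' where T: "T = homology_class C n z'" "z' \<in> cycles C n" "zigzag n z' b' a'"
    using zigzag_exists by (metis imageE j.D.carrier_homology)
  show "connecting A i B j n (S \<otimes>\<^bsub>homology C n\<^esub> T) =
      connecting A i B j n S \<otimes>\<^bsub>homology A (n - 1)\<^esub> connecting A i B j n T"
    using S T zigzag_mult[OF S(3) T(3)]
    by (simp add: j.D.mult_homology_class i.C.mult_homology_class connecting_class zigzag_cycle)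
qed

lemma exact_B:
  "exact_at (homology A n) (homology_map B i n) (homology B n) (homology_map C j n) (homology C n)"
  unfolding exact_at_def
proof (intro conjI i.C.comm_group_homology i.D.comm_group_homology j.D.comm_group_homology
    i.homology_map_hom j.homology_map_hom equalityI subsetI)
  fix S assume "S \<in> homology_map B i n ` carrier (homology A n)"
  then obtain a where a: "a \<in> cycles A n" "S = homology_class B n (i n a)"
    by (auto simp: i.C.carrier_homology i.homology_map_class)
  then have "a \<in> carrier (chains A n)"
    by (simp add: i.C.mem_cycles)
  then show "S \<in> kernel (homology B n) (homology C n) (homology_map C j n)"
    using a i.D.homology_class_closed by (simp add: kernel_def j.homology_map_class j.D.one_homology)
next
  fix S assume "S \<in> kernel (homology B n) (homology C n) (homology_map C j n)"
  then obtain z where z: "z \<in> cycles B n" "S = homology_class B n z"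
    and "homology_map C j n S = \<one>\<^bsub>homology C n\<^esub>"
    by (auto simp: kernel_def i.D.carrier_homology)
  then obtain c where c: "c \<in> carrier (chains C (n + 1))" "j n z = bdry C (n + 1) c"
    by (auto simp: j.homology_map_class j.D.homology_class_one_iff)
  then obtain b where b: "b \<in> carrier (chains B (n + 1))" "j (n + 1) b = c"
    using j_lift by blast
  then have jz: "j n z = j n (bdry B (n + 1) b)"
    using c j.bdry_commute[OF b(1)] by simp
  \<comment> \<open>\<open>z\<close> corrected by a boundary, hence in the same class, but now
    killed by \<open>j\<close> and therefore coming from a cycle of \<open>A\<close>.\<close>
  let ?x = "inv\<^bsub>chains B n\<^esub> bdry B (n + 1) b \<otimes>\<^bsub>chains B n\<^esub> z"
  have z': "z \<in> carrier (chains B n)" "bdry B n z = \<one>\<^bsub>chains B (n - 1)\<^esub>"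
    using z by (auto simp: i.D.mem_cycles)
  obtain a where a: "a \<in> carrier (chains A n)" "i n a = ?x"
    using i_lift[of ?x n] b(1) z'(1) jz by auto
  have "?x \<in> cycles B n"
    using b(1) z' by (simp add: i.D.mem_cycles i.D.bdry_bdry)
  then have "a \<in> cycles A n"
    using a cycle_if_i_cycle by simp
  moreover have "z = bdry B (n + 1) b \<otimes>\<^bsub>chains B n\<^esub> i n a"
    unfolding a(2) using b(1) z'(1) by (simp flip: i.D.ch.m_assoc)
  then have "S = homology_class B n (i n a)"
    unfolding z(2) i.D.homology_class_eq_iff[OF z(1) i.maps_cycles[OF \<open>a \<in> cycles A n\<close>]]
    using b(1) by blast
  ultimately show "S \<in> homology_map B i n ` carrier (homology A n)"
    by (simp add: i.C.carrier_homology image_image i.homology_map_class)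
qed

lemma exact_C:
  "exact_at (homology B n) (homology_map C j n) (homology C n) (connecting A i B j n)
    (homology A (n - 1))"
  unfolding exact_at_def
proof (intro conjI i.C.comm_group_homology i.D.comm_group_homology j.D.comm_group_homology
    j.homology_map_hom connecting_hom equalityI subsetI)
  fix S assume "S \<in> homology_map C j n ` carrier (homology B n)"
  then obtain b where b: "b \<in> cycles B n" "S = homology_class C n (j n b)"
    by (auto simp: i.D.carrier_homology j.homology_map_class)
  \<comment> \<open>A cycle of \<open>B\<close> serves as its own lift, and its trivial boundary
    pulls back to the unit.\<close>
  then have "zigzag n (j n b) b \<one>\<^bsub>chains A (n - 1)\<^esub>"
    by (simp add: zigzag_def i.D.mem_cycles)
  then show "S \<in> kernel (homology C n) (homology A (n - 1)) (connecting A i B j n)"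
    using b j.D.homology_class_closed by (simp add: kernel_def connecting_class i.C.one_homology)
next
  fix S assume "S \<in> kernel (homology C n) (homology A (n - 1)) (connecting A i B j n)"
  then obtain z where z: "z \<in> cycles C n" "S = homology_class C n z"
    and one: "connecting A i B j n S = \<one>\<^bsub>homology A (n - 1)\<^esub>"
    by (auto simp: kernel_def j.D.carrier_homology)
  then obtain b a where zz: "zigzag n z b a"
    using zigzag_exists by blast
  then obtain d where d: "d \<in> carrier (chains A n)" "a = bdry A n d"
    using one z i.C.homology_class_one_iff[OF zigzag_cycle[OF zz]] by (auto simp: connecting_class)
  \<comment> \<open>Since \<open>a\<close> bounds \<open>d\<close>, removing \<open>i n d\<close>
    from the lift \<open>b\<close> makes it a cycle without changing its image under
    \<open>j\<close>.\<close>
  let ?x = "b \<otimes>\<^bsub>chains B n\<^esub> inv\<^bsub>chains B n\<^esub> i n d"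
  have "?x \<in> cycles B n" "j n ?x = z"
    using zz d by (auto simp: zigzag_def i.D.mem_cycles i.bdry_commute)
  then have "S = homology_map C j n (homology_class B n ?x)"
    using z j.homology_map_class by simp
  then show "S \<in> homology_map C j n ` carrier (homology B n)"
    using i.D.homology_class_closed[OF \<open>?x \<in> cycles B n\<close>] by blast
qed

lemma exact_A:
  "exact_at (homology C n) (connecting A i B j n) (homology A (n - 1)) (homology_map B i (n - 1))
    (homology B (n - 1))"
  unfolding exact_at_def
proof (intro conjI i.C.comm_group_homology i.D.comm_group_homology j.D.comm_group_homology
    i.homology_map_hom connecting_hom equalityI subsetI)
  fix S assume "S \<in> connecting A i B j n ` carrier (homology C n)"
  then obtain z where z: "z \<in> cycles C n" "S = connecting A i B j n (homology_class C n z)"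
    unfolding j.D.carrier_homology by blast
  then obtain b a where zz: "zigzag n z b a"
    using zigzag_exists by blast
  then have S: "S = homology_class A (n - 1) a"
    using z(2) connecting_class by simp
  have a: "a \<in> cycles A (n - 1)"
    using zz by (rule zigzag_cycle)
  have "\<exists>c\<in>carrier (chains B n). i (n - 1) a = bdry B n c"
    using zz by (auto simp: zigzag_def)
  then have "homology_class B (n - 1) (i (n - 1) a) = \<one>\<^bsub>homology B (n - 1)\<^esub>"
    using i.D.homology_class_one_iff[OF i.maps_cycles[OF a]] by simp
  then show "S \<in> kernel (homology A (n - 1)) (homology B (n - 1)) (homology_map B i (n - 1))"
    using a S i.C.homology_class_closed by (simp add: kernel_def i.homology_map_class)
next
  fix S assume "S \<in> kernel (homology A (n - 1)) (homology B (n - 1)) (homology_map B i (n - 1))"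
  then obtain a where a: "a \<in> cycles A (n - 1)" "S = homology_class A (n - 1) a"
    and "homology_map B i (n - 1) S = \<one>\<^bsub>homology B (n - 1)\<^esub>"
    by (auto simp: kernel_def i.C.carrier_homology)
  then obtain b where b: "b \<in> carrier (chains B n)" "i (n - 1) a = bdry B n b"
    using i.D.homology_class_one_iff[OF i.maps_cycles[OF a(1)]] by (auto simp: i.homology_map_class)
  \<comment> \<open>The chain \<open>b\<close> that bounds the image of \<open>a\<close> in
    \<open>B\<close> is itself the lift; the class sought is that of \<open>j n b\<close>.\<close>
  then have zz: "zigzag n (j n b) b a"
    using a by (simp add: zigzag_def i.C.mem_cycles)
  then show "S \<in> connecting A i B j n ` carrier (homology C n)"
    using a j.D.homology_class_closed[OF zigzag_start_cycle[OF zz]] connecting_class[OF zz] by force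
qed

end

section \<open>Naturality of the induced maps and of the connecting homomorphism\<close>

lemma homology_map_square:
  assumes f: "chain_hom A B f" and f': "chain_hom A' B' f'"
    and p: "chain_hom A A' p" and q: "chain_hom B B' q"
    and eq: "\<And>a n. a \<in> carrier (chains A n) \<Longrightarrow> q n (f n a) = f' n (p n a)"
  shows "commuting_square (homology A n) (homology_map B f n) (homology B n)
    (homology_map A' p n) (homology_map B' q n)
    (homology A' n) (homology_map B' f' n) (homology B' n)"
proof -
  have A: "ab_complex A"
    using f by (rule chain_hom.axioms)
  have "homology_map B' q n (homology_map B f n S) = homology_map B' f' n (homology_map A' p n S)"
    if S: "S \<in> carrier (homology A n)" for S
  proof -
    obtain a where a: "a \<in> cycles A n" and S': "S = homology_class A n a"
      using S unfolding ab_complex.carrier_homology[OF A] by blast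
    have "q n (f n a) = f' n (p n a)"
      using a eq unfolding ab_complex.mem_cycles[OF A] by blast
    then show ?thesis
      unfolding S' chain_hom.homology_map_class[OF f a] chain_hom.homology_map_class[OF p a]
        chain_hom.homology_map_class[OF q chain_hom.maps_cycles[OF f a]]
        chain_hom.homology_map_class[OF f' chain_hom.maps_cycles[OF p a]]
      by simp
  qed
  then show ?thesis
    unfolding commuting_square_def using assms(1-4)[THEN chain_hom.homology_map_hom] by blast
qed

text \<open>The three chain maps carry a zigzag for \<open>z\<close> to a zigzag for its image, and
  by \<open>connecting_class\<close> any zigzag computes the connecting homomorphism.\<close>

lemma connecting_square:
  assumes E: "short_exact A B C i j" and E': "short_exact A' B' C' i' j'"
    and \<alpha>: "chain_hom A A' \<alpha>" and \<beta>: "chain_hom B B' \<beta>" and \<gamma>: "chain_hom C C' \<gamma>"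
    and i: "\<And>a n. a \<in> carrier (chains A n) \<Longrightarrow> \<beta> n (i n a) = i' n (\<alpha> n a)"
    and j: "\<And>b n. b \<in> carrier (chains B n) \<Longrightarrow> \<gamma> n (j n b) = j' n (\<beta> n b)"
  shows "commuting_square (homology C n) (connecting A i B j n) (homology A (n - 1))
    (homology_map C' \<gamma> n) (homology_map A' \<alpha> (n - 1))
    (homology C' n) (connecting A' i' B' j' n) (homology A' (n - 1))"
proof -
  have C: "ab_complex C"
    using \<gamma> by (rule chain_hom.axioms)
  have "homology_map A' \<alpha> (n - 1) (connecting A i B j n S) =
      connecting A' i' B' j' n (homology_map C' \<gamma> n S)"
    if S: "S \<in> carrier (homology C n)" for S
  proof -
    obtain z where z: "z \<in> cycles C n" and S': "S = homology_class C n z"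
      using S unfolding ab_complex.carrier_homology[OF C] by blast
    then obtain b a where zz: "short_exact.zigzag A B i j n z b a"
      using short_exact.zigzag_exists[OF E] by blast
    then have ba: "b \<in> carrier (chains B n)" "a \<in> carrier (chains A (n - 1))" "z = j n b"
      "i (n - 1) a = bdry B n b"
      unfolding short_exact.zigzag_def[OF E] by auto
    have "i' (n - 1) (\<alpha> (n - 1) a) = bdry B' n (\<beta> n b)"
      using i[OF ba(2)] ba(4) chain_hom.bdry_commute[OF \<beta> ba(1)] by simp
    then have zz': "short_exact.zigzag A' B' i' j' n (\<gamma> n z) (\<beta> n b) (\<alpha> (n - 1) a)"
      unfolding short_exact.zigzag_def[OF E']
      using j[OF ba(1)] ba(3) hom_in_carrier[OF chain_hom.hom[OF \<beta>] ba(1)]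
        hom_in_carrier[OF chain_hom.hom[OF \<alpha>] ba(2)]
      by simp
    show ?thesis
      unfolding S' short_exact.connecting_class[OF E zz] chain_hom.homology_map_class[OF \<gamma> z]
        short_exact.connecting_class[OF E' zz']
      by (rule chain_hom.homology_map_class[OF \<alpha> short_exact.zigzag_cycle[OF E zz]])
  qed
  then show ?thesis
    unfolding commuting_square_def
    using short_exact.connecting_hom[OF E] short_exact.connecting_hom[OF E']
      chain_hom.homology_map_hom[OF \<alpha>] chain_hom.homology_map_hom[OF \<gamma>]
    by blast
qed

section \<open>Chain complexes with coefficients\<close>

lemma chains_tensor_complex [simp]: "chains (tensor_complex C G) n = tensor (chains C n) G"
  and bdry_tensor_complex [simp]: "bdry (tensor_complex C G) n = tensor_map (chains C (n - 1)) G (bdry C n)"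
  by (simp_all add: tensor_complex_def)

text \<open>Two successive boundaries compose to the constant homomorphism to the unit. Tensoring
  respects the composite and turns the constant homomorphism into a constant one.\<close>

lemma ab_complex_tensor_complex:
  assumes "ab_complex C" "group G"
  shows "ab_complex (tensor_complex C G)"
proof -
  interpret ab_complex C by (rule assms(1))
  have gr: "group (chains C n)" for n
    by (rule ch.is_group)
  show ?thesis
  proof (rule ab_complex.intro)
    fix n
    show "comm_group (chains (tensor_complex C G) n)"
      using comm_group_tensor[OF gr assms(2)] by simp
    show "bdry (tensor_complex C G) n \<in> hom (chains (tensor_complex C G) n) (chains (tensor_complex C G) (n - 1))"
      using tensor_map_hom[OF gr gr assms(2) bdry_hom] by simp
    fix u assume "u \<in> carrier (chains (tensor_complex C G) (n + 1))"
    then have u: "u \<in> carrier (tensor (chains C (n + 1)) G)"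
      by simp
    have bd: "bdry C (n + 1) \<in> hom (chains C (n + 1)) (chains C n)"
      using bdry_hom[of "n + 1"] by simp
    have triv: "(\<lambda>_. \<one>\<^bsub>chains C (n - 1)\<^esub>) \<in> hom (chains C (n + 1)) (chains C (n - 1))"
      by (simp add: hom_def)
    have "tensor_map (chains C (n - 1)) G (bdry C n) (tensor_map (chains C n) G (bdry C (n + 1)) u) =
        tensor_map (chains C (n - 1)) G (\<lambda>_. \<one>\<^bsub>chains C (n - 1)\<^esub>) u"
      by (rule tensor_map_comp[OF gr gr gr assms(2) bd bdry_hom triv bdry_bdry u])
    also have "\<dots> = \<one>\<^bsub>tensor (chains C (n - 1)) G\<^esub>"
      by (rule tensor_map_trivial[OF gr gr assms(2) triv refl u])
    finally show "bdry (tensor_complex C G) n (bdry (tensor_complex C G) (n + 1) u) =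
        \<one>\<^bsub>chains (tensor_complex C G) (n - 1)\<^esub>"
      by simp
  qed
qed

lemma tensor_chain_map_commute:
  assumes f: "chain_hom A B f" and f': "chain_hom A' B' f'"
    and p: "chain_hom A A' p" and q: "chain_hom B B' q" and "group G"
    and eq: "\<And>a. a \<in> carrier (chains A n) \<Longrightarrow> q n (f n a) = f' n (p n a)"
    and u: "u \<in> carrier (chains (tensor_complex A G) n)"
  shows "tensor_chain_map B' G q n (tensor_chain_map B G f n u) =
    tensor_chain_map B' G f' n (tensor_chain_map A' G p n u)"
proof -
  note ax = chain_hom.axioms(1,2)
  show ?thesis
    unfolding tensor_chain_map_def
    by (rule tensor_map_commute[OF ab_complex.comm[OF ax(1)[OF f], THEN comm_group.axioms(2)]
          ab_complex.comm[OF ax(2)[OF f], THEN comm_group.axioms(2)]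
          ab_complex.comm[OF ax(2)[OF p], THEN comm_group.axioms(2)]
          ab_complex.comm[OF ax(2)[OF q], THEN comm_group.axioms(2)] assms(5)
          chain_hom.hom[OF f] chain_hom.hom[OF q] chain_hom.hom[OF p] chain_hom.hom[OF f']
          eq u[unfolded chains_tensor_complex]])
qed

lemma chain_hom_tensor_chain_map:
  assumes "chain_hom C D \<phi>" "group G"
  shows "chain_hom (tensor_complex C G) (tensor_complex D G) (tensor_chain_map D G \<phi>)"
proof -
  interpret chain_hom C D \<phi> by (rule assms(1))
  have gr: "group (chains C n)" "group (chains D n)" for n
    by (rule C.ch.is_group D.ch.is_group)+
  show ?thesis
  proof (intro chain_hom.intro chain_hom_axioms.intro ab_complex_tensor_complex assms(2)
      C.ab_complex_axioms D.ab_complex_axioms)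
    fix n
    show "tensor_chain_map D G \<phi> n \<in> hom (chains (tensor_complex C G) n) (chains (tensor_complex D G) n)"
      unfolding tensor_chain_map_def chains_tensor_complex
      by (rule tensor_map_hom[OF gr assms(2) hom])
    fix u assume "u \<in> carrier (chains (tensor_complex C G) n)"
    then have u: "u \<in> carrier (tensor (chains C n) G)"
      by simp
    show "bdry (tensor_complex D G) n (tensor_chain_map D G \<phi> n u) =
        tensor_chain_map D G \<phi> (n - 1) (bdry (tensor_complex C G) n u)"
      unfolding tensor_chain_map_def bdry_tensor_complex
      by (rule tensor_map_commute[OF gr(1) gr(2) gr(1) gr(2) assms(2) hom D.bdry_hom C.bdry_hom hom
            bdry_commute u])
  qed
qed

text \<open>Unrelated splittings in the various degrees suffice, because injectivity, surjectivity
  and exactness each concern a single degree.\<close>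

lemma short_exact_tensor:
  assumes i: "chain_hom A B i" and j: "chain_hom B C j" and G: "group G"
    and split: "\<And>n. \<exists>r s. split_exact (chains A n) (chains B n) (chains C n) (i n) (j n) r s"
  shows "short_exact (tensor_complex A G) (tensor_complex B G) (tensor_complex C G)
    (tensor_chain_map B G i) (tensor_chain_map C G j)"
proof (intro short_exact.intro short_exact_axioms.intro chain_hom_tensor_chain_map i j G)
  fix n
  obtain r s where "split_exact (chains A n) (chains B n) (chains C n) (i n) (j n) r s"
    using split by blast
  note E = split_exact.tensor[OF this G]
  show "inj_on (tensor_chain_map B G i n) (carrier (chains (tensor_complex A G) n))"
    unfolding tensor_chain_map_def chains_tensor_complex by (rule split_exact.inj[OF E])
  show "tensor_chain_map C G j n ` carrier (chains (tensor_complex B G) n) =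
      carrier (chains (tensor_complex C G) n)"
    unfolding tensor_chain_map_def chains_tensor_complex by (rule split_exact.surj[OF E])
  show "tensor_chain_map B G i n ` carrier (chains (tensor_complex A G) n) =
      kernel (chains (tensor_complex B G) n) (chains (tensor_complex C G) n) (tensor_chain_map C G j n)"
    unfolding tensor_chain_map_def chains_tensor_complex by (rule split_exact.exact[OF E])
qed

section \<open>The rack boundary\<close>

lemma frag_cmul_diff: "frag_cmul k (a - b) = frag_cmul k a - frag_cmul k b"
  using frag_cmul_distrib2[of k "a - b" b] by simp

lemma frag_extend_extend: "frag_extend f (frag_extend g c) = frag_extend (\<lambda>x. frag_extend f (g x)) c"
  using subset_UNIV[of "Poly_Mapping.keys c"]
  by (induction c rule: frag_induction) (auto simp: frag_extend_diff)

lemma keys_frag_extend_subset: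
  "(\<And>x. x \<in> Poly_Mapping.keys c \<Longrightarrow> Poly_Mapping.keys (f x) \<subseteq> S) \<Longrightarrow>
    Poly_Mapping.keys (frag_extend f c) \<subseteq> S"
  using keys_frag_extend[of f c] by blast

lemma keys_add_subset:
  "Poly_Mapping.keys a \<subseteq> S \<Longrightarrow> Poly_Mapping.keys b \<subseteq> S \<Longrightarrow> Poly_Mapping.keys (a + b) \<subseteq> S"
  using keys_add[of a b] by blast

lemma keys_cmul_subset: "Poly_Mapping.keys a \<subseteq> S \<Longrightarrow> Poly_Mapping.keys (frag_cmul k a) \<subseteq> S"
  using keys_cmul[of k a] by blast

lemma frag_extend_hom:
  assumes "\<And>x. x \<in> S \<Longrightarrow> Poly_Mapping.keys (f x) \<subseteq> T"
  shows "frag_extend f \<in> hom (free_Abelian_group S) (free_Abelian_group T)"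
proof (rule homI)
  fix x assume "x \<in> carrier (free_Abelian_group S)"
  then show "frag_extend f x \<in> carrier (free_Abelian_group T)"
    using assms keys_frag_extend_subset[of x f T] by auto
qed (simp add: frag_extend_add)

text \<open>Tuples are extended on the right because an entry acts on those to its left: the last
  entry acts on all others and is acted on by none, which gives the boundary a simple
  recursion.\<close>

definition snoc_chain :: "'a \<Rightarrow> ('a list \<Rightarrow>\<^sub>0 int) \<Rightarrow> ('a list \<Rightarrow>\<^sub>0 int)"
  where "snoc_chain y = frag_extend (\<lambda>xs. frag_of (xs @ [y]))"

lemma rack_boundary_tuple_Nil [simp]: "rack_boundary_tuple s [] = 0"
  by (simp add: rack_boundary_tuple_def)

lemma rack_boundary_tuple_snoc:
  "rack_boundary_tuple s (xs @ [y]) = snoc_chain y (rack_boundary_tuple s xs) +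
    frag_cmul ((-1) ^ Suc (length xs)) (frag_of xs - frag_of (map (\<lambda>x. s x y) xs))"
proof (cases "xs = []")
  \<comment> \<open>The index range starts at 2, so a 1-tuple has no last term; the correction
    vanishes too, both of its terms being \<open>frag_of []\<close>.\<close>
  case True
  then show ?thesis
    by (simp add: rack_boundary_tuple_def snoc_chain_def)
next
  case False
  let ?t = "\<lambda>xs i. frag_cmul ((-1) ^ i)
      (frag_of (take (i - 1) xs @ drop i xs) -
       frag_of (map (\<lambda>y. s y (xs ! (i - 1))) (take (i - 1) xs) @ drop i xs))"
  have "?t (xs @ [y]) i = snoc_chain y (?t xs i)" if "i \<in> {2..length xs}" for i
  proof -
    have "i - Suc 0 < length xs"
      using that by auto
    then show ?thesis
      using that by (simp add: snoc_chain_def frag_extend_cmul frag_extend_diff nth_append)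
  qed
  then have "(\<Sum>i = 2..length xs. ?t (xs @ [y]) i) = snoc_chain y (rack_boundary_tuple s xs)"
    by (simp add: rack_boundary_tuple_def snoc_chain_def frag_extend_sum)
  moreover have "{2..length (xs @ [y])} = insert (Suc (length xs)) {2..length xs}"
    using False by (cases xs) auto
  ultimately show ?thesis
    unfolding rack_boundary_tuple_def[of s "xs @ [y]"] by (simp add: add.commute)
qed

text \<open>All tuples in the support have the same length, so the correction terms of
  \<open>rack_boundary_tuple_snoc\<close> carry one common sign that can be taken out.\<close>

lemma rack_boundary_snoc_chain:
  assumes "Poly_Mapping.keys c \<subseteq> {xs. length xs = m}"
  shows "rack_boundary s (snoc_chain y c) = snoc_chain y (rack_boundary s c) +
    frag_cmul ((-1) ^ Suc m) (c - frag_extend (\<lambda>xs. frag_of (map (\<lambda>x. s x y) xs)) c)"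
  using assms
  by (induction c rule: frag_induction)
    (auto simp: rack_boundary_def snoc_chain_def frag_extend_diff rack_boundary_tuple_snoc frag_cmul_diff
      simp del: power_Suc)

text \<open>Used for quandle homomorphisms and also for right translations of a single quandle,
  where the homomorphism law is self-distributivity.\<close>

lemma rack_boundary_tuple_map:
  assumes "\<And>a b. a \<in> X \<Longrightarrow> b \<in> X \<Longrightarrow> f (s a b) = t (f a) (f b)" "set xs \<subseteq> X"
  shows "rack_boundary_tuple t (map f xs) = frag_extend (\<lambda>xs. frag_of (map f xs)) (rack_boundary_tuple s xs)"
  using assms(2)
proof (induction xs rule: rev_induct)
  case (snoc y xs)
  then have *: "map (\<lambda>x. f (s x y)) xs = map (\<lambda>x. t (f x) (f y)) xs"
    using assms(1) by auto
  then show ?case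
    using snoc
    by (simp add: rack_boundary_tuple_snoc snoc_chain_def frag_extend_extend frag_extend_add
        frag_extend_cmul frag_extend_diff o_def * del: power_Suc)
qed simp

section \<open>The boundary squares to zero and preserves degeneracy\<close>

context quandle
begin

lemma map_star_subset: "y \<in> X \<Longrightarrow> set xs \<subseteq> X \<Longrightarrow> set (map (\<lambda>x. x \<star> y) xs) \<subseteq> X"
  using closed by auto

lemma keys_rack_boundary_tuple:
  "set xs \<subseteq> X \<Longrightarrow> Poly_Mapping.keys (rack_boundary_tuple (\<star>) xs) \<subseteq>
    {zs. zs \<noteq> [] \<and> Suc (length zs) = length xs \<and> set zs \<subseteq> X}"
proof (induction xs rule: rev_induct)
  case (snoc y xs)
  let ?S = "{zs. zs \<noteq> [] \<and> Suc (length zs) = length (xs @ [y]) \<and> set zs \<subseteq> X}"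
  have "Poly_Mapping.keys (snoc_chain y (rack_boundary_tuple (\<star>) xs)) \<subseteq> ?S"
    unfolding snoc_chain_def using snoc by (intro keys_frag_extend_subset) auto
  moreover have "Poly_Mapping.keys (frag_cmul ((-1) ^ Suc (length xs))
      (frag_of xs - frag_of (map (\<lambda>x. x \<star> y) xs))) \<subseteq> ?S"
  \<comment> \<open>For empty \<open>xs\<close> the two terms cancel, which keeps the empty list out
    of the support.\<close>
  proof (cases "xs = []")
    case False
    then show ?thesis
      using snoc.prems map_star_subset[of y xs] by (intro keys_cmul_subset keys_diff_subset) auto
  qed simp
  ultimately show ?case
    unfolding rack_boundary_tuple_snoc by (rule keys_add_subset)
qed simp

lemma rack_boundary_rack_boundary_tuple:
  "set xs \<subseteq> X \<Longrightarrow> rack_boundary (\<star>) (rack_boundary_tuple (\<star>) xs) = 0"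
proof (induction xs rule: rev_induct)
  case Nil
  show ?case by (simp add: rack_boundary_def)
next
  case (snoc y xs)
  show ?case
  proof (cases "xs = []")
    case True
    then show ?thesis
      by (simp add: rack_boundary_def rack_boundary_tuple_def)
  next
    case False
    let ?c = "rack_boundary_tuple (\<star>) xs"
    let ?T = "frag_extend (\<lambda>xs. frag_of (map (\<lambda>x. x \<star> y) xs))"
    obtain m where m: "length xs = Suc m"
      using False by (cases xs) auto
    have "Poly_Mapping.keys ?c \<subseteq> {zs. length zs = m}"
      using keys_rack_boundary_tuple[of xs] snoc.prems m by auto
    note snocc = rack_boundary_snoc_chain[OF this, of "(\<star>)" y]
    have map: "rack_boundary_tuple (\<star>) (map (\<lambda>x. x \<star> y) xs) = ?T ?c"
      using snoc.prems by (intro rack_boundary_tuple_map[where X = X]) (auto simp: self_distrib)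
    \<comment> \<open>The first summand comes from appending \<open>y\<close> to \<open>?c\<close>,
      the second is the boundary of the correction for \<open>xs\<close>. Tuples in
      \<open>?c\<close> are one entry shorter than \<open>xs\<close>, so the signs are
      opposite.\<close>
    have "rack_boundary (\<star>) (rack_boundary_tuple (\<star>) (xs @ [y])) =
        frag_cmul ((-1) ^ Suc m) (?c - ?T ?c) + frag_cmul ((-1) ^ Suc (Suc m)) (?c - ?T ?c)"
      using snoc m snocc
      by (simp add: rack_boundary_tuple_snoc rack_boundary_def frag_extend_add frag_extend_cmul
          frag_extend_diff map snoc_chain_def del: power_Suc)
    also have "\<dots> = frag_cmul ((-1) ^ Suc m + (-1) ^ Suc (Suc m)) (?c - ?T ?c)"
      by (simp only: frag_cmul_distrib)
    also have "\<dots> = 0"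
      by simp
    finally show ?thesis .
  qed
qed

text \<open>A repetition inside \<open>xs\<close> survives appending and translation. The other case
  is a repetition formed by the last two entries alone.\<close>

lemma keys_rack_boundary_degenerate:
  "set xs \<subseteq> X \<Longrightarrow> \<not> distinct_adj xs \<Longrightarrow>
    Poly_Mapping.keys (rack_boundary_tuple (\<star>) xs) \<subseteq> {zs. \<not> distinct_adj zs}"
proof (induction xs rule: rev_induct)
  case (snoc y xs)
  show ?case
  proof (cases "distinct_adj xs")
    case False
    have "Poly_Mapping.keys (snoc_chain y (rack_boundary_tuple (\<star>) xs)) \<subseteq> {zs. \<not> distinct_adj zs}"
      unfolding snoc_chain_def using snoc False by (intro keys_frag_extend_subset) auto
    moreover have "Poly_Mapping.keys (frag_cmul ((-1) ^ Suc (length xs))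
      (frag_of xs - frag_of (map (\<lambda>x. x \<star> y) xs))) \<subseteq> {zs. \<not> distinct_adj zs}"
      using False by (intro keys_cmul_subset keys_diff_subset) (auto dest: distinct_adj_mapD)
    ultimately show ?thesis
      unfolding rack_boundary_tuple_snoc by (rule keys_add_subset)
  next
    case True
    with snoc.prems have "xs \<noteq> []" "last xs = y"
      by (auto simp: distinct_adj_append_iff)
    then obtain ys where ys: "xs = ys @ [y]"
      by (metis append_butlast_last_id)
    have "y \<star> y = y"
      using snoc.prems by (simp add: idem)
    \<comment> \<open>The correction for the inner \<open>y\<close>, once the outer \<open>y\<close>
      is appended, equals that for the outer \<open>y\<close> up to sign. What remains has
      \<open>y\<close> appended twice, so all its tuples end in a repetition.\<close>
    then have "rack_boundary_tuple (\<star>) (xs @ [y]) = snoc_chain y (snoc_chain y (rack_boundary_tuple (\<star>) ys))"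
      unfolding rack_boundary_tuple_snoc[of _ xs] unfolding ys rack_boundary_tuple_snoc
      by (simp add: snoc_chain_def frag_extend_add frag_extend_cmul frag_extend_diff
          flip: minus_frag_cmul)
    moreover have "Poly_Mapping.keys (snoc_chain y (snoc_chain y (rack_boundary_tuple (\<star>) ys)))
        \<subseteq> {zs. \<not> distinct_adj zs}"
      unfolding snoc_chain_def frag_extend_extend
      by (intro keys_frag_extend_subset) (auto simp: distinct_adj_append_iff)
    ultimately show ?thesis by simp
  qed
qed simp

lemma rack_boundary_tuple_closed:
  "xs \<in> tuples X n \<Longrightarrow> Poly_Mapping.keys (rack_boundary_tuple (\<star>) xs) \<subseteq> tuples X (n - 1)"
  using keys_rack_boundary_tuple[of xs] by (auto simp: tuples_def)

end

text \<open>In terms of \<open>distinct_adj\<close>, the rules for append and \<open>map\<close>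
  replace index arithmetic.\<close>

lemma degenerate_tuples_alt: "degenerate_tuples X n = {xs \<in> tuples X n. \<not> distinct_adj xs}"
  by (auto simp: degenerate_tuples_def distinct_adj_conv_nth)

lemma (in quandle) rack_boundary_tuple_degenerate_closed:
  "xs \<in> degenerate_tuples X n \<Longrightarrow>
    Poly_Mapping.keys (rack_boundary_tuple (\<star>) xs) \<subseteq> degenerate_tuples X (n - 1)"
  using rack_boundary_tuple_closed[of xs n] keys_rack_boundary_degenerate[of xs]
  by (auto simp: degenerate_tuples_alt tuples_def)

lemma (in quandle) rack_boundary_rack_boundary:
  assumes "Poly_Mapping.keys c \<subseteq> tuples X n"
  shows "rack_boundary (\<star>) (rack_boundary (\<star>) c) = 0"
  unfolding rack_boundary_def frag_extend_extend
  by (rule frag_extend_eq_0, rule rack_boundary_rack_boundary_tuple[unfolded rack_boundary_def])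
    (use assms in \<open>auto simp: tuples_def\<close>)


section \<open>The rack, degenerate and quandle complexes\<close>

lemma degenerate_tuples_subset: "degenerate_tuples X n \<subseteq> tuples X n"
  by (auto simp: degenerate_tuples_def)

text \<open>An equality of whole group structures, so the degenerate chains inherit all facts about
  free abelian groups. Subtraction builds every chain supported on degenerate tuples from
  generators, and group operations never enlarge that support.\<close>

lemma degenerate_chains_eq: "degenerate_chains X n = free_Abelian_group (degenerate_tuples X n)"
proof -
  let ?F = "free_Abelian_group (tuples X n)" and ?D = "degenerate_tuples X n"
  have sub: "frag_of ` ?D \<subseteq> carrier ?F"
    using degenerate_tuples_subset[of X n] by auto
  have "c \<in> generate ?F (frag_of ` ?D)" if "Poly_Mapping.keys c \<subseteq> ?D" for c
    using that
  proof (induction c rule: frag_induction)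
    case zero
    show ?case using generate.one[of ?F] by simp
  next
    case (one x)
    then show ?case by (auto intro: generate.incl)
  next
    case (diff a b)
    have "Poly_Mapping.keys b \<subseteq> tuples X n"
      using group.generate_in_carrier[OF group_free_Abelian_group sub diff(2)] by simp
    then show ?case
      using generate.eng[OF diff(1) group.generate_m_inv_closed[OF group_free_Abelian_group sub diff(2)]]
      by simp
  qed
  moreover have "Poly_Mapping.keys c \<subseteq> ?D" if "c \<in> generate ?F (frag_of ` ?D)" for c
    using that
  proof (induction c rule: generate.induct)
    case (inv h)
    then have "Poly_Mapping.keys h \<subseteq> tuples X n"
      using sub by auto
    with inv show ?case by auto
  next
    case (eng h1 h2)
    then show ?case by (simp add: keys_add_subset)
  qed auto
  ultimately have "generate ?F (frag_of ` ?D) = {c. Poly_Mapping.keys c \<subseteq> ?D}"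
    by blast
  \<comment> \<open>\<open>subgroup_generated\<close> intersects its generators with the carrier
    first.\<close>
  moreover have "carrier ?F \<inter> frag_of ` ?D = frag_of ` ?D"
    using sub by blast
  ultimately show ?thesis
    unfolding degenerate_chains_def rack_chains_def subgroup_generated_def
    by (simp add: free_Abelian_group_def)
qed

section \<open>Free abelian groups on part of a basis as direct summands\<close>

lemma subgroup_free_Abelian_group:
  assumes "T \<subseteq> S"
  shows "subgroup (carrier (free_Abelian_group T)) (free_Abelian_group S)"
proof (rule group.subgroupI[OF group_free_Abelian_group])
  have "0 \<in> carrier (free_Abelian_group T)" by simp
  then show "carrier (free_Abelian_group T) \<noteq> {}" by blast
  show "carrier (free_Abelian_group T) \<subseteq> carrier (free_Abelian_group S)"
    using assms by auto
  fix a assume a: "a \<in> carrier (free_Abelian_group T)"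
  then show "inv\<^bsub>free_Abelian_group S\<^esub> a \<in> carrier (free_Abelian_group T)"
    using assms by (subst inv_free_Abelian_group) auto
  fix b assume "b \<in> carrier (free_Abelian_group T)"
  with a show "a \<otimes>\<^bsub>free_Abelian_group S\<^esub> b \<in> carrier (free_Abelian_group T)"
    by (simp add: keys_add_subset)
qed

text \<open>The retraction keeps the basis elements in \<open>T\<close> and kills the others. The
  complementary projection \<open>?p\<close> factors through the quotient and becomes the
  section.\<close>

lemma split_exact_free_Abelian_group:
  assumes "T \<subseteq> S"
  defines "F \<equiv> free_Abelian_group S" and "K \<equiv> carrier (free_Abelian_group T)"
  shows "\<exists>r s. split_exact (free_Abelian_group T) F (F Mod K) (\<lambda>c. c) (\<lambda>c. K #>\<^bsub>F\<^esub> c) r s"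
proof -
  let ?r = "frag_extend (\<lambda>x. if x \<in> T then frag_of x else 0)"
  let ?p = "\<lambda>c. c - ?r c"
  have sub: "subgroup K F"
    unfolding F_def K_def using assms(1) by (rule subgroup_free_Abelian_group)
  have F: "comm_group F"
    unfolding F_def by (rule abelian_free_Abelian_group)
  have norm: "K \<lhd> F"
    by (rule comm_group.subgroup_imp_normal[OF F sub])
  have keys_r: "Poly_Mapping.keys (?r c) \<subseteq> T" for c
    by (rule keys_frag_extend_subset) auto
  have r_id: "?r c = c" if "Poly_Mapping.keys c \<subseteq> T" for c
    using that by (induction c rule: frag_induction) (auto simp: frag_extend_diff)
  have r_hom: "?r \<in> hom F (free_Abelian_group T)"
    using keys_r by (intro homI) (auto simp: F_def frag_extend_add)
  have p_hom: "?p \<in> hom F F"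
  proof (rule homI)
    fix x assume "x \<in> carrier F"
    then show "?p x \<in> carrier F"
      using keys_diff_subset[of x S "?r x"] order_trans[OF keys_r assms(1)] by (simp add: F_def)
  qed (simp add: F_def frag_extend_add)
  \<comment> \<open>\<open>?p\<close> kills \<open>K\<close>, because \<open>?r\<close> is the
    identity there; hence \<open>?p\<close> is constant on cosets.\<close>
  have eq: "?p x = ?p y" if xy: "x \<in> carrier F" "y \<in> carrier F" "K #>\<^bsub>F\<^esub> x = K #>\<^bsub>F\<^esub> y" for x y
  proof -
    obtain k where "k \<in> K" "x = k + y"
      using xy rcos_eq_iff[OF comm_group.axioms(2)[OF F] sub, of x y] by (auto simp: F_def)
    then show ?thesis
      using r_id[of k] by (simp add: K_def frag_extend_add)
  qed
  obtain s where s: "s \<in> hom (F Mod K) F" "\<And>x. x \<in> carrier F \<Longrightarrow> s (K #>\<^bsub>F\<^esub> x) = ?p x"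
    by (rule FactGroup_universal[OF p_hom norm eq]) (assumption+, rule that)
  have "split_exact (free_Abelian_group T) F (F Mod K) (\<lambda>c. c) (\<lambda>c. K #>\<^bsub>F\<^esub> c) ?r s"
  proof (intro split_exact.intro split_exact_axioms.intro r_hom s(1) F abelian_free_Abelian_group
      comm_group.abelian_FactGroup[OF F sub] normal.r_coset_hom_Mod[OF norm])
    show "(\<lambda>c. c) \<in> hom (free_Abelian_group T) F"
      using assms(1) by (intro homI) (auto simp: F_def)
  next
    fix a assume "a \<in> carrier (free_Abelian_group T)"
    then show "?r a = a" by (simp add: r_id)
  next
    fix c assume "c \<in> carrier (F Mod K)"
    then obtain x where x: "x \<in> carrier F" "c = K #>\<^bsub>F\<^esub> x"
      by (auto simp: carrier_FactGroup)
    \<comment> \<open>\<open>?p x\<close> differs from \<open>x\<close> by \<open>?r x\<close>, an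
      element of \<open>K\<close>; so \<open>s\<close> picks a representative within each
      coset.\<close>
    have "\<exists>k\<in>K. ?p x = k \<otimes>\<^bsub>F\<^esub> x"
      using keys_r by (intro bexI[of _ "- ?r x"]) (auto simp: F_def K_def)
    then have "K #>\<^bsub>F\<^esub> ?p x = K #>\<^bsub>F\<^esub> x"
      using rcos_eq_iff[OF comm_group.axioms(2)[OF F] sub hom_in_carrier[OF p_hom x(1)] x(1)] by simp
    then show "K #>\<^bsub>F\<^esub> s c = c"
      using x s(2) by simp
  next
    fix b assume "b \<in> carrier F"
    then show "?r b \<otimes>\<^bsub>F\<^esub> s (K #>\<^bsub>F\<^esub> b) = b"
      using s(2) by (simp add: F_def)
  qed
  then show ?thesis by blast
qed

lemma incl_chain_eq: "incl_chain n = (\<lambda>c. c)"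
  by (simp add: incl_chain_def fun_eq_iff)

lemma split_exact_rack:
  "\<exists>r s. split_exact (chains (C_D X t) n) (chains (C_R X t) n) (chains (C_Q X t) n)
    (incl_chain n) (proj_chain X n) r s"
  using split_exact_free_Abelian_group[OF degenerate_tuples_subset[of X n]]
  by (simp add: C_D_def C_R_def C_Q_def proj_chain_def[abs_def] incl_chain_eq degenerate_chains_eq
      rack_chains_def)

context quandle
begin

lemma rack_boundary_hom: "rack_boundary (\<star>) \<in> hom (rack_chains X n) (rack_chains X (n - 1))"
  unfolding rack_boundary_def rack_chains_def by (intro frag_extend_hom rack_boundary_tuple_closed)

lemma rack_boundary_degenerate_hom:
  "rack_boundary (\<star>) \<in> hom (degenerate_chains X n) (degenerate_chains X (n - 1))"
  unfolding rack_boundary_def degenerate_chains_eq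
  by (intro frag_extend_hom rack_boundary_tuple_degenerate_closed)

lemma ab_complex_C_R: "ab_complex (C_R X (\<star>))"
proof (rule ab_complex.intro)
  fix n c assume "c \<in> carrier (chains (C_R X (\<star>)) (n + 1))"
  then show "bdry (C_R X (\<star>)) n (bdry (C_R X (\<star>)) (n + 1) c) = \<one>\<^bsub>chains (C_R X (\<star>)) (n - 1)\<^esub>"
    using rack_boundary_rack_boundary[of c "n + 1"] by (simp add: C_R_def rack_chains_def)
qed (use rack_boundary_hom in \<open>simp_all add: C_R_def rack_chains_def abelian_free_Abelian_group\<close>)

lemma ab_complex_C_D: "ab_complex (C_D X (\<star>))"
proof (rule ab_complex.intro)
  fix n c assume "c \<in> carrier (chains (C_D X (\<star>)) (n + 1))"
  then show "bdry (C_D X (\<star>)) n (bdry (C_D X (\<star>)) (n + 1) c) = \<one>\<^bsub>chains (C_D X (\<star>)) (n - 1)\<^esub>"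
    using rack_boundary_rack_boundary[of c "n + 1"] degenerate_tuples_subset[of X "n + 1"]
    by (auto simp: C_D_def degenerate_chains_eq)
qed (use rack_boundary_degenerate_hom in
    \<open>simp_all add: C_D_def degenerate_chains_eq abelian_free_Abelian_group\<close>)

lemma chain_hom_incl_chain: "chain_hom (C_D X (\<star>)) (C_R X (\<star>)) incl_chain"
proof (intro chain_hom.intro chain_hom_axioms.intro ab_complex_C_D ab_complex_C_R)
  show "incl_chain n \<in> hom (chains (C_D X (\<star>)) n) (chains (C_R X (\<star>)) n)" for n
    using degenerate_tuples_subset[of X n]
    by (intro homI) (auto simp: C_D_def C_R_def incl_chain_eq degenerate_chains_eq rack_chains_def)
qed (simp add: incl_chain_eq C_D_def C_R_def)

end

section \<open>The quandle complex as a quotient of the rack complex\<close>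

lemma comm_group_rack_chains: "comm_group (rack_chains X n)"
  by (simp add: rack_chains_def abelian_free_Abelian_group)

lemma subgroup_degenerate_chains: "subgroup (carrier (degenerate_chains X n)) (rack_chains X n)"
  unfolding degenerate_chains_eq rack_chains_def
  by (rule subgroup_free_Abelian_group[OF degenerate_tuples_subset])

text \<open>Source and target may differ in both quandle and degree, so that this covers the
  boundary (same quandle, degree lowered by one) and the induced maps (two quandles, same
  degree).\<close>

lemma quot_map_proj_chain:
  assumes "h \<in> hom (rack_chains X n) (rack_chains Y m)" "h ` carrier (degenerate_chains X n) \<subseteq> carrier (degenerate_chains Y m)"
    and "c \<in> carrier (rack_chains X n)"
  shows "quot_map (rack_chains Y m) (carrier (degenerate_chains Y m)) h (proj_chain X n c) = proj_chain Y m (h c)"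
  unfolding proj_chain_def
  by (rule quot_map_rcos[OF comm_group.axioms(2)[OF comm_group_rack_chains]
        comm_group.axioms(2)[OF comm_group_rack_chains] subgroup_degenerate_chains
        subgroup_degenerate_chains assms])

lemma quot_map_rack_hom:
  assumes "h \<in> hom (rack_chains X n) (rack_chains Y m)" "h ` carrier (degenerate_chains X n) \<subseteq> carrier (degenerate_chains Y m)"
  shows "quot_map (rack_chains Y m) (carrier (degenerate_chains Y m)) h \<in>
    hom (rack_chains X n Mod carrier (degenerate_chains X n)) (rack_chains Y m Mod carrier (degenerate_chains Y m))"
  by (rule quot_map_hom[OF comm_group_rack_chains comm_group_rack_chains subgroup_degenerate_chains
        subgroup_degenerate_chains assms])

lemma carrier_C_Q: "carrier (chains (C_Q X t) n) = proj_chain X n ` carrier (rack_chains X n)"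
  by (simp add: C_Q_def carrier_FactGroup proj_chain_def[abs_def])

lemma proj_chain_hom: "proj_chain X n \<in> hom (rack_chains X n) (chains (C_Q X t) n)"
  unfolding proj_chain_def[abs_def] C_Q_def
  using normal.r_coset_hom_Mod[OF comm_group.subgroup_imp_normal[OF comm_group_rack_chains subgroup_degenerate_chains]]
  by simp

lemma proj_chain_zero: "proj_chain X n 0 = \<one>\<^bsub>chains (C_Q X t) n\<^esub>"
  using group.coset_join2[OF comm_group.axioms(2)[OF comm_group_rack_chains] _ subgroup_degenerate_chains, of 0 X n]
  by (simp add: proj_chain_def C_Q_def rack_chains_def degenerate_chains_eq)

context quandle
begin

lemma rack_boundary_degenerate_image:
  "rack_boundary (\<star>) ` carrier (degenerate_chains X n) \<subseteq> carrier (degenerate_chains X (n - 1))"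
  using hom_carrier[OF rack_boundary_degenerate_hom] .

lemma bdry_C_Q_proj_chain:
  "c \<in> carrier (rack_chains X n) \<Longrightarrow>
    bdry (C_Q X (\<star>)) n (proj_chain X n c) = proj_chain X (n - 1) (rack_boundary (\<star>) c)"
  unfolding C_Q_def chain_complex.simps
  by (rule quot_map_proj_chain[OF rack_boundary_hom rack_boundary_degenerate_image])

lemma ab_complex_C_Q: "ab_complex (C_Q X (\<star>))"
proof (rule ab_complex.intro)
  fix n
  show "comm_group (chains (C_Q X (\<star>)) n)"
    using comm_group.abelian_FactGroup[OF comm_group_rack_chains subgroup_degenerate_chains]
    by (simp add: C_Q_def)
  show "bdry (C_Q X (\<star>)) n \<in> hom (chains (C_Q X (\<star>)) n) (chains (C_Q X (\<star>)) (n - 1))"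
    using quot_map_rack_hom[OF rack_boundary_hom rack_boundary_degenerate_image] by (simp add: C_Q_def)
  fix S assume "S \<in> carrier (chains (C_Q X (\<star>)) (n + 1))"
  then obtain c where c: "c \<in> carrier (rack_chains X (n + 1))" and S: "S = proj_chain X (n + 1) c"
    unfolding carrier_C_Q by blast
  have "rack_boundary (\<star>) c \<in> carrier (rack_chains X n)"
    using hom_in_carrier[OF rack_boundary_hom c] by simp
  moreover have "rack_boundary (\<star>) (rack_boundary (\<star>) c) = 0"
    using c by (intro rack_boundary_rack_boundary[of c "n + 1"]) (simp add: rack_chains_def)
  ultimately show "bdry (C_Q X (\<star>)) n (bdry (C_Q X (\<star>)) (n + 1) S) = \<one>\<^bsub>chains (C_Q X (\<star>)) (n - 1)\<^esub>"
    unfolding S bdry_C_Q_proj_chain[OF c] by (simp add: bdry_C_Q_proj_chain proj_chain_zero)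
qed

lemma chain_hom_proj_chain: "chain_hom (C_R X (\<star>)) (C_Q X (\<star>)) (proj_chain X)"
proof (intro chain_hom.intro chain_hom_axioms.intro ab_complex_C_R ab_complex_C_Q)
  show "proj_chain X n \<in> hom (chains (C_R X (\<star>)) n) (chains (C_Q X (\<star>)) n)" for n
    using proj_chain_hom by (simp add: C_R_def)
qed (simp add: C_R_def bdry_C_Q_proj_chain)

lemma short_exact_rack:
  assumes "group G"
  shows "short_exact (tensor_complex (C_D X (\<star>)) G) (tensor_complex (C_R X (\<star>)) G)
    (tensor_complex (C_Q X (\<star>)) G) (tensor_chain_map (C_R X (\<star>)) G incl_chain)
    (tensor_chain_map (C_Q X (\<star>)) G (proj_chain X))"
  by (rule short_exact_tensor[OF chain_hom_incl_chain chain_hom_proj_chain assms split_exact_rack])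

end

section \<open>Chain maps induced by a quandle homomorphism\<close>

locale quandle_morphism = X: quandle X s + Y: quandle Y t
  for X :: "'a set" and s and Y :: "'b set" and t +
  fixes f :: "'a \<Rightarrow> 'b"
  assumes f: "f \<in> quandle_hom X s Y t"
begin

lemma f_closed: "x \<in> X \<Longrightarrow> f x \<in> Y"
  and f_star: "x \<in> X \<Longrightarrow> y \<in> X \<Longrightarrow> f (s x y) = t (f x) (f y)"
  using f by (auto simp: quandle_hom_def)

lemma map_tuples: "xs \<in> tuples X n \<Longrightarrow> map f xs \<in> tuples Y n"
  using f_closed by (auto simp: tuples_def)

lemma map_chain_hom: "map_chain f n \<in> hom (rack_chains X n) (rack_chains Y n)"
  unfolding map_chain_def rack_chains_def by (intro frag_extend_hom) (simp add: map_tuples)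

text \<open>Equal neighbours have equal images, so degenerate tuples stay degenerate.\<close>

lemma map_chain_degenerate_hom: "map_chain f n \<in> hom (degenerate_chains X n) (degenerate_chains Y n)"
  unfolding map_chain_def degenerate_chains_eq
  by (intro frag_extend_hom) (auto simp: degenerate_tuples_alt map_tuples dest: distinct_adj_mapD)

lemma rack_boundary_map_chain:
  assumes "Poly_Mapping.keys c \<subseteq> tuples X n"
  shows "rack_boundary t (map_chain f n c) = map_chain f (n - 1) (rack_boundary s c)"
  unfolding map_chain_def rack_boundary_def frag_extend_extend frag_extend_of
  by (rule frag_extend_eq, rule rack_boundary_tuple_map[where X = X])
    (use assms f_star in \<open>auto simp: tuples_def\<close>)

lemma chain_hom_R: "chain_hom (C_R X s) (C_R Y t) (map_chain f)"
proof (intro chain_hom.intro chain_hom_axioms.intro X.ab_complex_C_R Y.ab_complex_C_R)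
  show "map_chain f n \<in> hom (chains (C_R X s) n) (chains (C_R Y t) n)" for n
    using map_chain_hom by (simp add: C_R_def)
qed (simp add: C_R_def rack_chains_def rack_boundary_map_chain)

lemma chain_hom_D: "chain_hom (C_D X s) (C_D Y t) (map_chain f)"
proof (intro chain_hom.intro chain_hom_axioms.intro X.ab_complex_C_D Y.ab_complex_C_D)
  show "map_chain f n \<in> hom (chains (C_D X s) n) (chains (C_D Y t) n)" for n
    using map_chain_degenerate_hom by (simp add: C_D_def)
  show "bdry (C_D Y t) n (map_chain f n c) = map_chain f (n - 1) (bdry (C_D X s) n c)"
    if "c \<in> carrier (chains (C_D X s) n)" for n c
    using that rack_boundary_map_chain[of c n] degenerate_tuples_subset[of X n]
    by (auto simp: C_D_def degenerate_chains_eq)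
qed

lemma map_chain_Q_proj_chain:
  "c \<in> carrier (rack_chains X n) \<Longrightarrow> map_chain_Q Y f n (proj_chain X n c) = proj_chain Y n (map_chain f n c)"
  unfolding map_chain_Q_def
  by (rule quot_map_proj_chain[OF map_chain_hom hom_carrier[OF map_chain_degenerate_hom]])

lemma chain_hom_Q: "chain_hom (C_Q X s) (C_Q Y t) (map_chain_Q Y f)"
proof (intro chain_hom.intro chain_hom_axioms.intro X.ab_complex_C_Q Y.ab_complex_C_Q)
  fix n
  show "map_chain_Q Y f n \<in> hom (chains (C_Q X s) n) (chains (C_Q Y t) n)"
    using quot_map_rack_hom[OF map_chain_hom hom_carrier[OF map_chain_degenerate_hom]]
    by (simp add: C_Q_def map_chain_Q_def)
  fix S assume "S \<in> carrier (chains (C_Q X s) n)"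
  then obtain c where c: "c \<in> carrier (rack_chains X n)" and S: "S = proj_chain X n c"
    unfolding carrier_C_Q by blast
  then have "rack_boundary t (map_chain f n c) = map_chain f (n - 1) (rack_boundary s c)"
    by (intro rack_boundary_map_chain) (simp add: rack_chains_def)
  then show "bdry (C_Q Y t) n (map_chain_Q Y f n S) = map_chain_Q Y f (n - 1) (bdry (C_Q X s) n S)"
    unfolding S X.bdry_C_Q_proj_chain[OF c] map_chain_Q_proj_chain[OF c]
      Y.bdry_C_Q_proj_chain[OF hom_in_carrier[OF map_chain_hom c]]
      map_chain_Q_proj_chain[OF hom_in_carrier[OF X.rack_boundary_hom c]]
    by simp
qed

end

theorem proposition3p3:
  fixes X :: "'a set" and s :: "'a \<Rightarrow> 'a \<Rightarrow> 'a"
    and G :: "('g, 'm) monoid_scheme"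
  assumes "quandle X s" and "comm_group G"
  shows "(\<forall>n::int.
      exact_at (H_D X s G n) (i_star X s G n) (H_R X s G n) (j_star X s G n) (H_Q X s G n) \<and>
      exact_at (H_R X s G n) (j_star X s G n) (H_Q X s G n) (bdry_star X s G n) (H_D X s G (n - 1)) \<and>
      exact_at (H_Q X s G n) (bdry_star X s G n) (H_D X s G (n - 1)) (i_star X s G (n - 1))
        (H_R X s G (n - 1)))
    \<and> (\<forall>(Y :: 'b set) t f. quandle Y t \<longrightarrow> f \<in> quandle_hom X s Y t \<longrightarrow> (\<forall>n::int.
      commuting_square (H_D X s G n) (i_star X s G n) (H_R X s G n)
        (star_D Y t G f n) (star_R Y t G f n)
        (H_D Y t G n) (i_star Y t G n) (H_R Y t G n) \<and>
      commuting_square (H_R X s G n) (j_star X s G n) (H_Q X s G n)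
        (star_R Y t G f n) (star_Q Y t G f n)
        (H_R Y t G n) (j_star Y t G n) (H_Q Y t G n) \<and>
      commuting_square (H_Q X s G n) (bdry_star X s G n) (H_D X s G (n - 1))
        (star_Q Y t G f n) (star_D Y t G f (n - 1))
        (H_Q Y t G n) (bdry_star Y t G n) (H_D Y t G (n - 1))))"
proof (intro conjI allI impI)
  have G: "group G"
    using assms(2) by (rule comm_group.axioms)
  note E = quandle.short_exact_rack[OF _ G]
  note defs = H_D_def H_R_def H_Q_def i_star_def j_star_def bdry_star_def star_D_def star_R_def star_Q_def
  fix n
  show "exact_at (H_D X s G n) (i_star X s G n) (H_R X s G n) (j_star X s G n) (H_Q X s G n)"
    unfolding defs by (rule short_exact.exact_B[OF E[OF assms(1)]])
  show "exact_at (H_R X s G n) (j_star X s G n) (H_Q X s G n) (bdry_star X s G n) (H_D X s G (n - 1))"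
    unfolding defs by (rule short_exact.exact_C[OF E[OF assms(1)]])
  show "exact_at (H_Q X s G n) (bdry_star X s G n) (H_D X s G (n - 1)) (i_star X s G (n - 1))
        (H_R X s G (n - 1))"
    unfolding defs by (rule short_exact.exact_A[OF E[OF assms(1)]])
  fix Y :: "'b set" and t f
  assume Y: "quandle Y t" and f: "f \<in> quandle_hom X s Y t"
  have M: "quandle_morphism X s Y t f"
    by (intro quandle_morphism.intro quandle_morphism_axioms.intro assms(1) Y f)
  note D = quandle_morphism.chain_hom_D[OF M] and R = quandle_morphism.chain_hom_R[OF M]
    and Q = quandle_morphism.chain_hom_Q[OF M]
  note incl = quandle.chain_hom_incl_chain and proj = quandle.chain_hom_proj_chain
  \<comment> \<open>The squares with the inclusion and the projection already commute on integral
    chains; functoriality transports them to coefficients in \<open>G\<close>.\<close>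
  have "map_chain f m (incl_chain m a) = incl_chain m (map_chain f m a)" for m a
    by (simp add: incl_chain_eq)
  note i = tensor_chain_map_commute[OF incl[OF assms(1)] incl[OF Y] D R G this]
  have "map_chain_Q Y f m (proj_chain X m a) = proj_chain Y m (map_chain f m a)"
    if "a \<in> carrier (chains (C_R X s) m)" for m a
    using that quandle_morphism.map_chain_Q_proj_chain[OF M] by (simp add: C_R_def)
  note j = tensor_chain_map_commute[OF proj[OF assms(1)] proj[OF Y] R Q G this]
  note T = chain_hom_tensor_chain_map[OF _ G]
  show "commuting_square (H_D X s G n) (i_star X s G n) (H_R X s G n)
        (star_D Y t G f n) (star_R Y t G f n)
        (H_D Y t G n) (i_star Y t G n) (H_R Y t G n)"
    unfolding defs
    by (rule homology_map_square[OF T[OF incl[OF assms(1)]] T[OF incl[OF Y]] T[OF D] T[OF R] i])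
  show "commuting_square (H_R X s G n) (j_star X s G n) (H_Q X s G n)
        (star_R Y t G f n) (star_Q Y t G f n)
        (H_R Y t G n) (j_star Y t G n) (H_Q Y t G n)"
    unfolding defs
    by (rule homology_map_square[OF T[OF proj[OF assms(1)]] T[OF proj[OF Y]] T[OF R] T[OF Q] j])
  show "commuting_square (H_Q X s G n) (bdry_star X s G n) (H_D X s G (n - 1))
        (star_Q Y t G f n) (star_D Y t G f (n - 1))
        (H_Q Y t G n) (bdry_star Y t G n) (H_D Y t G (n - 1))"
    unfolding defs
    by (rule connecting_square[OF E[OF assms(1)] E[OF Y] T[OF D] T[OF R] T[OF Q] i j])
qed

end
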